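(* Let $\alpha > 1$ and let $p \ge 1$ be an integer. Let $\mu_1,\ldots,\mu_p$ be fixed centered probability laws on $\mathbb{R}$ with unit variance and a finite moment of order $2\alpha$. For all integers $n_0,\ldots,n_p \ge 1$, let $A^{(1)} \in \mathbb{R}^{n_0\times n_1}, \ldots, A^{(p)} \in \mathbb{R}^{n_{p-1}\times n_p}$ be independent random matrices such that, for each $q$, the entries of $A^{(q)}$ are i.i.d. with law $\mu_q$, and let $P := A^{(1)} \cdots A^{(p)} \in \mathbb{R}^{n_0 \times n_p}$. Let $m \ge 1$ be an arbitrary integer (the quantity below does not depend on $m$). Then $$n_p^{-1} (n_0 \cdots n_{p-1})^{-\frac 1 2}\|\mathbf{1}_{m,n_0} P\|_{\ell^\infty \to \ell^\infty} \xrightarrow[n_0 \asymp \cdots \asymp n_p \to \infty]{\text{(prob.)}} \sqrt{\frac 2 \pi}.$$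
   Context: $\mathbf{1}_{m,n}$ denotes the $m$-by-$n$ matrix with all entries equal to $1$. For a matrix $A = (A_{ij}) \in \mathbb{R}^{m\times n}$, $\|A\|_{\ell^\infty \to \ell^\infty} := \sup_{|x|_\infty \le 1} |Ax|_\infty = \max_{1 \le i \le m} \sum_{j = 1}^n |A_{ij}|$, where $|x|_\infty=\max_j|x_j|$. For random variables $U(n_0,\ldots,n_p)$ and $X$, the notation $U(n_0,\ldots, n_p) \xrightarrow[n_0 \asymp \cdots \asymp n_p \to \infty]{\text{(prob.)}} X$ means: for every $C < +\infty$ and $\varepsilon,\delta > 0$, there exists $N \in \mathbb{N}$ such that if $N \le n_q \le C n_{q'}$ for all $q,q' \in \{0,\ldots, p\}$, then $\mathbb{P}[|U(n_0,\ldots,n_p) - X| \ge \varepsilon] \le \delta$. *)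

theory Defs
  imports "HOL-Probability.Probability" "Jordan_Normal_Form.Matrix"
begin

(* "$" is kept for the entries of the carrier-based vectors of Jordan_Normal_Form. *)
no_notation vec_nth (infixl "$" 90)

definition linf_norm :: "real vec \<Rightarrow> real" where
  "linf_norm x = Max ((\<lambda>j. \<bar>x $ j\<bar>) ` {..<dim_vec x})"

text \<open>Dimension-zero vectors, for which the maximum is unspecified, are never used below.\<close>

definition linf_op_norm :: "real mat \<Rightarrow> real" where
  "linf_op_norm A =
     (SUP x \<in> {x \<in> carrier_vec (dim_col A). linf_norm x \<le> 1}. linf_norm (A *\<^sub>v x))"

definition ones_mat :: "nat \<Rightarrow> nat \<Rightarrow> real mat" where
  "ones_mat m n = mat m n (\<lambda>_. 1)"

text \<open>The product \<open>A 1 * A 2 * \<dots> * A p\<close>, for \<open>p \<ge> 1\<close>.\<close>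

definition mat_chain_prod :: "(nat \<Rightarrow> real mat) \<Rightarrow> nat \<Rightarrow> real mat" where
  "mat_chain_prod A p = foldl (*) (A 1) (map A [2..<Suc p])"

text \<open>The Borel sigma-algebra on \<open>m \<times> n\<close> matrices, as the one generated by the entries.
  A measurable map into this space takes its values in \<open>carrier_mat m n\<close>.\<close>

definition borel_mat :: "nat \<Rightarrow> nat \<Rightarrow> real mat measure" where
  "borel_mat m n =
     vimage_algebra (carrier_mat m n) (\<lambda>B. \<lambda>(i, j) \<in> {..<m} \<times> {..<n}. B $$ (i, j))
       (Pi\<^sub>M ({..<m} \<times> {..<n}) (\<lambda>_. borel))"

definition iid_entries :: "'w measure \<Rightarrow> ('w \<Rightarrow> real mat) \<Rightarrow> nat \<Rightarrow> nat \<Rightarrow> real measure \<Rightarrow> bool" where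
  "iid_entries M B m n \<mu> \<longleftrightarrow>
     prob_space.indep_vars M (\<lambda>_. borel) (\<lambda>(i, j) \<omega>. B \<omega> $$ (i, j)) ({..<m} \<times> {..<n}) \<and>
     (\<forall>i<m. \<forall>j<n. distr M borel (\<lambda>\<omega>. B \<omega> $$ (i, j)) = \<mu>)"

text \<open>The tuple \<open>(n\<^sub>0, \<dots>, n\<^sub>p)\<close> is a list of length \<open>p + 1\<close>, and \<open>U ns\<close> may live on
  its own probability space \<open>M ns\<close>.\<close>

definition tendsto_in_prob_comparable ::
  "nat \<Rightarrow> (nat list \<Rightarrow> 'w measure) \<Rightarrow> (nat list \<Rightarrow> 'w \<Rightarrow> real) \<Rightarrow> ('w \<Rightarrow> real) \<Rightarrow> bool" where
  "tendsto_in_prob_comparable p M U X \<longleftrightarrow>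
     (\<forall>(C::real) \<epsilon> \<delta>. \<epsilon> > 0 \<longrightarrow> \<delta> > 0 \<longrightarrow>
        (\<exists>N::nat. \<forall>ns. length ns = p + 1 \<longrightarrow>
           (\<forall>q\<le>p. \<forall>q'\<le>p. N \<le> ns ! q \<and> real (ns ! q) \<le> C * real (ns ! q')) \<longrightarrow>
           measure (M ns) {\<omega> \<in> space (M ns). \<bar>U ns \<omega> - X \<omega>\<bar> \<ge> \<epsilon>} \<le> \<delta>))"

end

theory Submission
  imports Defs
begin

text \<open>All rows of \<open>1 A\<^sub>1 \<dots> A\<^sub>p\<close> are equal, so its operator norm is the \<open>\<ell>\<^sup>1\<close> norm of one row. Starting
  from the row vector \<open>v\<^sub>0 = (1, \<dots>, 1) / sqrt n\<^sub>0\<close>, put \<open>v\<^sub>q = v\<^sub>q\<^sub>-\<^sub>1 A\<^sub>q / sqrt n\<^sub>q\<close>. Given \<open>v\<^sub>q\<^sub>-\<^sub>1\<close>, the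
  entries of \<open>w = v\<^sub>q\<^sub>-\<^sub>1 A\<^sub>q\<close> are independent sums of independent variables with weights \<open>v\<^sub>q\<^sub>-\<^sub>1\<close>. If the
  Euclidean norm of \<open>v\<^sub>q\<^sub>-\<^sub>1\<close> is close to 1 and its entries are uniformly small, these sums are nearly
  standard normal, with nearly the right second moment, so their squares are uniformly integrable.
  The weak law of large numbers then shows that \<open>v\<^sub>q\<close> has the same two properties with high
  probability, and that at the last step the mean of \<open>\<bar>w\<^sub>j\<bar>\<close> is close to the first absolute moment
  \<open>sqrt (2 / \<pi>)\<close> of the normal law.\<close>

section \<open>A central limit theorem uniform in the weights\<close>

text \<open>Second-order Taylor expansion of the characteristic function. Replacing
  \<open>\<bar>s\<bar>\<close> by a bound \<open>r\<close> inside the integral makes the error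
  integral common to all arguments \<open>a i * t\<close> of a weighted sum, so only the factors
  \<open>s\<^sup>2\<close> remain to be summed.\<close>

lemma (in real_distribution) char_approx3_std:
  assumes "integrable M (\<lambda>x. x)" "integrable M (\<lambda>x. x\<^sup>2)" "expectation (\<lambda>x. x) = 0"
    "expectation (\<lambda>x. x\<^sup>2) = 1" "\<bar>s\<bar> \<le> r"
  shows "cmod (char M s - (1 - s\<^sup>2 / 2)) \<le> s\<^sup>2 / 6 * (LINT x|M. min (6 * x\<^sup>2) (r * \<bar>x\<bar> ^ 3))"
proof -
  have "cmod (char M s - (1 - s\<^sup>2 * 1 / 2)) \<le> s\<^sup>2 / 6 * expectation (\<lambda>x. min (6 * x\<^sup>2) (\<bar>s\<bar> * \<bar>x\<bar>^3))"
    using assms by (intro char_approx3) auto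
  also have "expectation (\<lambda>x. min (6 * x\<^sup>2) (\<bar>s\<bar> * \<bar>x\<bar>^3)) \<le> (LINT x|M. min (6 * x\<^sup>2) (r * \<bar>x\<bar> ^ 3))"
  proof (rule integral_mono)
    have int: "integrable M (\<lambda>x. min (6 * x\<^sup>2) (c * \<bar>x\<bar> ^ 3))" if "c \<ge> 0" for c
    proof (rule Bochner_Integration.integrable_bound)
      show "integrable M (\<lambda>x. 6 * x\<^sup>2)" using assms(2) by simp
      have "\<bar>min (6 * x\<^sup>2) (c * \<bar>x\<bar> ^ 3)\<bar> \<le> \<bar>6 * x\<^sup>2\<bar>" for x :: real
        using that by (simp add: min_def)
      thus "AE x in M. norm (min (6 * x\<^sup>2) (c * \<bar>x\<bar> ^ 3)) \<le> norm (6 * x\<^sup>2)" by simp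
    qed measurable
    show "integrable M (\<lambda>x. min (6 * x\<^sup>2) (\<bar>s\<bar> * \<bar>x\<bar> ^ 3))" by (rule int) simp
    show "integrable M (\<lambda>x. min (6 * x\<^sup>2) (r * \<bar>x\<bar> ^ 3))" by (rule int) (use assms(5) in simp)
    show "min (6 * x\<^sup>2) (\<bar>s\<bar> * \<bar>x\<bar> ^ 3) \<le> min (6 * x\<^sup>2) (r * \<bar>x\<bar> ^ 3)" for x
      using assms(5) by (intro min.mono mult_right_mono) auto
  qed
  finally show ?thesis by (simp add: mult_left_mono)
qed

text \<open>Dominated convergence with bound \<open>6 * x\<^sup>2\<close>: the minimum lets a finite
  second moment do the work of a third one.\<close>

lemma (in real_distribution) truncated_third_moment_tendsto_0:
  assumes "integrable M (\<lambda>x. x\<^sup>2)" "r \<longlonglongrightarrow> (0::real)" "\<And>n. r n \<ge> 0"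
  shows "(\<lambda>n. LINT x|M. min (6 * x\<^sup>2) (r n * \<bar>x\<bar> ^ 3)) \<longlonglongrightarrow> 0"
proof -
  have "(\<lambda>n. LINT x|M. min (6 * x\<^sup>2) (r n * \<bar>x\<bar> ^ 3)) \<longlonglongrightarrow> (LINT x|M. 0)"
  proof (rule integral_dominated_convergence [where w = "\<lambda>x. 6 * x^2"])
    have "(\<lambda>n. min (6 * x\<^sup>2) (r n * \<bar>x\<bar> ^ 3)) \<longlonglongrightarrow> min (6 * x\<^sup>2) (0 * \<bar>x\<bar> ^ 3)" for x
      by (intro tendsto_intros assms)
    thus "AE x in M. (\<lambda>n. min (6 * x\<^sup>2) (r n * \<bar>x\<bar> ^ 3)) \<longlonglongrightarrow> 0"
      by (simp add: min_absorb2)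
    show "AE x in M. norm (min (6 * x\<^sup>2) (r n * \<bar>x\<bar> ^ 3)) \<le> 6 * x\<^sup>2" for n
      using assms(3)[of n] by (intro AE_I2) (auto simp: min_def)
  qed (use assms in auto)
  thus ?thesis by simp
qed

locale standardized_law = real_distribution \<mu> for \<mu> :: "real measure" +
  assumes square_integrable: "integrable \<mu> (\<lambda>x. x\<^sup>2)"
    and mean_zero: "expectation (\<lambda>x. x) = 0"
    and second_moment: "expectation (\<lambda>x. x\<^sup>2) = 1"
begin

lemma integrable_id: "integrable \<mu> (\<lambda>x. x)"
  by (rule square_integrable_imp_integrable[OF _ square_integrable]) simp_all

end

text \<open>The normal law is itself an instance, so the Taylor estimate applies to both sides of
  the comparison with Gaussian sums.\<close>

interpretation std_normal: standardized_law std_normal_distribution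
proof (rule standardized_law.intro[OF real_dist_normal_dist], unfold_locales)
  show "integrable std_normal_distribution (\<lambda>x. x\<^sup>2)"
    by (rule integrable_std_normal_distribution_moment)
  show "integral\<^sup>L std_normal_distribution (\<lambda>x. x) = 0"
    using integral_std_normal_distribution_moment_odd[of 1] by simp
  show "integral\<^sup>L std_normal_distribution (\<lambda>x. x\<^sup>2) = 1"
    using std_normal_distribution_even_moments[of 1] by simp
qed

text \<open>The hypothesis on \<open>char \<nu>\<close> says that \<open>\<nu>\<close> is the law of \<open>\<Sum>i<k. a i * X i\<close> with i.i.d. \<open>X i\<close> of law
  \<open>\<mu>\<close>. Arguing by contradiction turns the uniform statement over \<open>k\<close> and \<open>a\<close> into one about a
  sequence of laws, to which Levy's continuity theorem applies.\<close>

lemma (in standardized_law) clt_weights_bounded: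
  fixes g :: "real \<Rightarrow> real"
  assumes g: "\<And>x. isCont g x" "\<And>x. \<bar>g x\<bar> \<le> B" and "\<epsilon> > 0"
  obtains \<delta> where "\<delta> > 0"
    "\<And>k a \<nu>. real_distribution \<nu> \<Longrightarrow> (\<And>t. char \<nu> t = (\<Prod>i<k. char \<mu> (a i * t))) \<Longrightarrow>
      \<bar>(\<Sum>i<k. (a i)\<^sup>2) - 1\<bar> \<le> \<delta> \<Longrightarrow> (\<And>i. i < (k::nat) \<Longrightarrow> \<bar>a i\<bar> \<le> \<delta>) \<Longrightarrow>
      \<bar>(LINT x|\<nu>. g x) - (LINT x|std_normal_distribution. g x)\<bar> \<le> \<epsilon>"
proof (rule ccontr)
  assume no_thesis: "\<not> thesis"
  note thesisI = that
  define P where "P \<delta> k a \<nu> \<longleftrightarrow> real_distribution \<nu> \<and> (\<forall>t. char \<nu> t = (\<Prod>i<k. char \<mu> (a i * t))) \<and>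
      \<bar>(\<Sum>i<k. (a i)\<^sup>2) - 1\<bar> \<le> \<delta> \<and> (\<forall>i<k. \<bar>a i\<bar> \<le> \<delta>) \<and>
      \<bar>(LINT x|\<nu>. g x) - (LINT x|std_normal_distribution. g x)\<bar> > \<epsilon>"
    for \<delta> :: real and k :: nat and a :: "nat \<Rightarrow> real" and \<nu> :: "real measure"
  have "\<exists>k a \<nu>. P \<delta> k a \<nu>" if "\<delta> > 0" for \<delta>
  proof (rule ccontr)
    assume "\<not> ?thesis"
    hence "\<not> P \<delta> k a \<nu>" for k a \<nu> by blast
    thus False
      using no_thesis thesisI[OF that] unfolding P_def not_less[symmetric] by blast
  qed
  hence "\<forall>n. \<exists>k a \<nu>. P (inverse (Suc n)) k a \<nu>" by simp
  then obtain k a \<nu> where "\<And>n. P (inverse (Suc n)) (k n) (a n) (\<nu> n)"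
    unfolding choice_iff by blast
  hence \<nu>: "\<And>n. real_distribution (\<nu> n)"
    and charf: "\<And>n t. char (\<nu> n) t = (\<Prod>i<k n. char \<mu> (a n i * t))"
    and norm: "\<And>n. \<bar>(\<Sum>i<k n. (a n i)\<^sup>2) - 1\<bar> \<le> inverse (Suc n)"
    and small: "\<And>n i. i < k n \<Longrightarrow> \<bar>a n i\<bar> \<le> inverse (Suc n)"
    and far: "\<And>n. \<bar>(LINT x|\<nu> n. g x) - (LINT x|std_normal_distribution. g x)\<bar> > \<epsilon>"
    unfolding P_def by auto
  have normlim: "(\<lambda>n. \<Sum>i<k n. (a n i)\<^sup>2) \<longlonglongrightarrow> 1"
    by (rule Lim_transform2[OF tendsto_const], rule Lim_null_comparison[OF _ LIMSEQ_inverse_real_of_nat])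
       (use norm in \<open>auto simp: abs_minus_commute\<close>)
  let ?N = std_normal_distribution
  have "weak_conv_m \<nu> ?N"
  proof (rule levy_continuity[OF \<nu> real_dist_normal_dist])
    fix t :: real
    \<comment> \<open>\<open>r n\<close> bounds every argument \<open>a n i * t\<close> at once, and
      \<open>L n\<close> collects the Taylor errors of \<open>\<mu>\<close> and of the normal law at
      that scale.\<close>
    define r where "r n = \<bar>t\<bar> * inverse (Suc n)" for n
    define L where "L n = (LINT x|\<mu>. min (6 * x\<^sup>2) (r n * \<bar>x\<bar> ^ 3)) +
      (LINT x|?N. min (6 * x\<^sup>2) (r n * \<bar>x\<bar> ^ 3))" for n
    have r: "r \<longlonglongrightarrow> 0" "\<And>n. r n \<ge> 0"
      unfolding r_def using tendsto_mult_right_zero[OF LIMSEQ_inverse_real_of_nat] by auto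
    have L: "L \<longlonglongrightarrow> 0"
      unfolding L_def
      using tendsto_add[OF truncated_third_moment_tendsto_0[OF square_integrable r]
         std_normal.truncated_third_moment_tendsto_0[OF std_normal.square_integrable r]] by simp
    \<comment> \<open>The comparison is with the same weighted sum of Gaussian variables; its
      characteristic function depends on the weights only through their square sum, which tends to
      1.\<close>
    have prodN: "(\<Prod>i<k n. char ?N (a n i * t)) = exp (- (\<Sum>i<k n. (a n i)\<^sup>2) * t\<^sup>2 / 2)" for n
    proof -
      have "(\<Prod>i<k n. char ?N (a n i * t)) = of_real (\<Prod>i<k n. exp (- (a n i * t)\<^sup>2 / 2))"
        by (simp add: char_std_normal_distribution)
      also have "(\<Prod>i<k n. exp (- (a n i * t)\<^sup>2 / 2)) = exp (\<Sum>i<k n. - (a n i * t)\<^sup>2 / 2)"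
        by (simp add: exp_sum)
      also have "(\<Sum>i<k n. - (a n i * t)\<^sup>2 / 2) = - (\<Sum>i<k n. (a n i)\<^sup>2) * t\<^sup>2 / 2"
        by (simp add: power_mult_distrib sum_negf sum_divide_distrib sum_distrib_right)
      finally show ?thesis .
    qed
    have "cmod (char (\<nu> n) t - (\<Prod>i<k n. char ?N (a n i * t))) \<le> (2 * t\<^sup>2 / 6) * L n" for n
    proof -
      have L0: "L n \<ge> 0"
        unfolding L_def using r(2)[of n] by (intro add_nonneg_nonneg integral_nonneg_AE) auto
      \<comment> \<open>Exchanging the factors one at a time: since all of them have modulus at most
        1, the products differ by at most the sum of the differences.\<close>
      have "cmod (char (\<nu> n) t - (\<Prod>i<k n. char ?N (a n i * t)))
          \<le> (\<Sum>i<k n. cmod (char \<mu> (a n i * t) - char ?N (a n i * t)))"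
        unfolding charf
        by (intro norm_prod_diff cmod_char_le_1 std_normal.cmod_char_le_1)
      also have "\<dots> \<le> (\<Sum>i<k n. (a n i)\<^sup>2 * (t\<^sup>2 / 6 * L n))"
      proof (rule sum_mono)
        fix i assume "i \<in> {..<k n}"
        hence s: "\<bar>a n i * t\<bar> \<le> r n"
          using small[of i n] by (auto simp: r_def abs_mult mult.commute intro!: mult_left_mono)
        \<comment> \<open>Both laws have mean 0 and variance 1, hence the same quadratic Taylor
          polynomial, which cancels in the difference.\<close>
        let ?q = "1 - (a n i * t)\<^sup>2 / 2 :: complex"
        have "cmod (char \<mu> (a n i * t) - char ?N (a n i * t))
          \<le> cmod (char \<mu> (a n i * t) - ?q) + cmod (char ?N (a n i * t) - ?q)"
          using norm_triangle_ineq4[of "char \<mu> (a n i * t) - ?q" "char ?N (a n i * t) - ?q"] by simp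
        also have "\<dots> \<le> (a n i * t)\<^sup>2 / 6 * (LINT x|\<mu>. min (6 * x\<^sup>2) (r n * \<bar>x\<bar> ^ 3)) +
            (a n i * t)\<^sup>2 / 6 * (LINT x|?N. min (6 * x\<^sup>2) (r n * \<bar>x\<bar> ^ 3))"
          using char_approx3_std[OF integrable_id square_integrable mean_zero second_moment s]
            std_normal.char_approx3_std[OF std_normal.integrable_id std_normal.square_integrable
              std_normal.mean_zero std_normal.second_moment s]
          by (intro add_mono) simp_all
        also have "\<dots> = (a n i)\<^sup>2 * (t\<^sup>2 / 6 * L n)"
          by (simp add: L_def power_mult_distrib algebra_simps)
        finally show "cmod (char \<mu> (a n i * t) - char ?N (a n i * t)) \<le> (a n i)\<^sup>2 * (t\<^sup>2 / 6 * L n)" .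
      qed
      also have "\<dots> = (\<Sum>i<k n. (a n i)\<^sup>2) * (t\<^sup>2 / 6 * L n)"
        by (simp add: sum_distrib_right)
      also have "(\<Sum>i<k n. (a n i)\<^sup>2) \<le> 2"
        using norm[of n] le_imp_inverse_le[of 1 "real (Suc n)"] by simp
      finally show ?thesis using L0 by (simp add: mult_right_mono mult.commute[of _ "t\<^sup>2"])
    qed
    hence diff: "(\<lambda>n. char (\<nu> n) t - (\<Prod>i<k n. char ?N (a n i * t))) \<longlonglongrightarrow> 0"
      by (intro Lim_null_comparison[OF _ tendsto_mult_right_zero[OF L, of "2 * t\<^sup>2 / 6"]]) auto
    have "(\<lambda>n. \<Prod>i<k n. char ?N (a n i * t)) \<longlonglongrightarrow> complex_of_real (exp (- 1 * t\<^sup>2 / 2))"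
      unfolding prodN
    proof (rule isCont_tendsto_compose[OF _ normlim])
      show "isCont (\<lambda>c. complex_of_real (exp (- c * t\<^sup>2 / 2))) 1"
        by (intro continuous_intros) simp
    qed
    hence "(\<lambda>n. \<Prod>i<k n. char ?N (a n i * t)) \<longlonglongrightarrow> char ?N t"
      by (simp add: char_std_normal_distribution)
    from Lim_transform[OF this diff] show "(\<lambda>n. char (\<nu> n) t) \<longlonglongrightarrow> char ?N t" .
  qed
  hence "(\<lambda>n. LINT x|\<nu> n. g x) \<longlonglongrightarrow> (LINT x|?N. g x)"
    using g(2) by (intro weak_conv_imp_integral_bdd_continuous_conv[OF \<nu> real_dist_normal_dist _ g(1)])
      simp_all
  then obtain n where "\<bar>(LINT x|\<nu> n. g x) - (LINT x|?N. g x)\<bar> < \<epsilon>"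
    using \<open>\<epsilon> > 0\<close> by (metis LIMSEQ_D order_refl real_norm_def)
  thus False using far[of n] by simp
qed

text \<open>The hypothesis on the weights in the central limit theorem above, and the invariant
  carried along the chain. A single parameter measures both defects, so that one tolerance is passed
  from each factor to the next.\<close>

definition nearly_normal_weights :: "real \<Rightarrow> nat \<Rightarrow> (nat \<Rightarrow> real) \<Rightarrow> bool" where
  "nearly_normal_weights \<delta> k a \<longleftrightarrow> \<bar>(\<Sum>i<k. (a i)\<^sup>2) - 1\<bar> \<le> \<delta> \<and> (\<forall>i<k. \<bar>a i\<bar> \<le> \<delta>)"

lemma nearly_normal_weights_mono:
  "nearly_normal_weights \<delta> k a \<Longrightarrow> \<delta> \<le> \<delta>' \<Longrightarrow> nearly_normal_weights \<delta>' k a"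
  unfolding nearly_normal_weights_def by force

section \<open>Unbounded test functions: the absolute value and the square\<close>

context standardized_law
begin

text \<open>The absolute value is cut off at a level \<open>K\<close> to reach a bounded test
  function; the part cut off is at most \<open>x\<^sup>2 / K\<close>, which the second moments
  control on both sides.\<close>

lemma clt_weights_abs:
  assumes "\<epsilon> > 0"
  obtains \<delta> where "\<delta> > 0"
    "\<And>k a \<nu>. real_distribution \<nu> \<Longrightarrow> (\<And>t. char \<nu> t = (\<Prod>i<k. char \<mu> (a i * t))) \<Longrightarrow>
      integrable \<nu> (\<lambda>x. x\<^sup>2) \<Longrightarrow> (LINT x|\<nu>. x\<^sup>2) = (\<Sum>i<k. (a i)\<^sup>2) \<Longrightarrow>
      nearly_normal_weights \<delta> k a \<Longrightarrow> \<bar>(LINT x|\<nu>. \<bar>x\<bar>) - sqrt (2 / pi)\<bar> \<le> \<epsilon>"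
proof -
  \<comment> \<open>The cut costs at most \<open>2 / K\<close> for \<open>\<nu>\<close>, whose
    second moment is at most 2 once \<open>\<delta>\<close> is at most 1, and \<open>1 / K\<close>
    for the normal law. Together this is \<open>\<epsilon> / 2\<close>, which leaves
    \<open>\<epsilon> / 2\<close> for the bounded comparison.\<close>
  define K where "K = 6 / \<epsilon>"
  have K: "K > 0" unfolding K_def using assms by simp
  have tail: "\<bar>(LINT x|\<nu>. \<bar>x\<bar>) - (LINT x|\<nu>. min \<bar>x\<bar> K)\<bar> \<le> (LINT x|\<nu>. x\<^sup>2) / K"
    if "real_distribution \<nu>" "integrable \<nu> (\<lambda>x. x\<^sup>2)" for \<nu>
  proof -
    interpret \<nu>: real_distribution \<nu> by fact
    have int: "integrable \<nu> (\<lambda>x. x)"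
      by (rule \<nu>.square_integrable_imp_integrable[OF _ that(2)]) simp
    have int2: "integrable \<nu> (\<lambda>x. min \<bar>x\<bar> K)"
      using K by (intro integrable_min integrable_abs int) simp
    have "(LINT x|\<nu>. \<bar>x\<bar>) - (LINT x|\<nu>. min \<bar>x\<bar> K) = (LINT x|\<nu>. \<bar>x\<bar> - min \<bar>x\<bar> K)"
      using int int2 by (simp add: Bochner_Integration.integral_diff)
    moreover have "\<dots> \<le> (LINT x|\<nu>. x\<^sup>2 / K)"
    proof (rule integral_mono)
      show "\<bar>x\<bar> - min \<bar>x\<bar> K \<le> x\<^sup>2 / K" for x
      proof (cases "\<bar>x\<bar> \<le> K")
        case False
        hence "\<bar>x\<bar> * K \<le> \<bar>x\<bar> * \<bar>x\<bar>" by (intro mult_left_mono) auto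
        hence "\<bar>x\<bar> \<le> x\<^sup>2 / K" using K by (simp add: field_simps power2_eq_square)
        thus ?thesis using K False by simp
      qed (use K in simp)
    qed (use int int2 that(2) in auto)
    moreover have "(LINT x|\<nu>. \<bar>x\<bar> - min \<bar>x\<bar> K) \<ge> 0"
      by (rule Bochner_Integration.integral_nonneg) simp
    ultimately show ?thesis by simp
  qed
  let ?N = std_normal_distribution
  have Nabs: "(LINT x|?N. \<bar>x\<bar>) = sqrt (2 / pi)"
    using std_normal_distribution_odd_moments_abs[of 0] by simp
  have c: "isCont (\<lambda>x. min \<bar>x\<bar> K) x" "\<bar>min \<bar>x\<bar> K\<bar> \<le> K" "\<epsilon> / 2 > 0" for x :: real
    using K assms by (auto intro!: continuous_intros)
  obtain \<delta> where \<delta>: "\<delta> > 0"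
    "\<And>k a \<nu>. real_distribution \<nu> \<Longrightarrow> (\<And>t. char \<nu> t = (\<Prod>i<k. char \<mu> (a i * t))) \<Longrightarrow>
      \<bar>(\<Sum>i<k. (a i)\<^sup>2) - 1\<bar> \<le> \<delta> \<Longrightarrow> (\<And>i. i < (k::nat) \<Longrightarrow> \<bar>a i\<bar> \<le> \<delta>) \<Longrightarrow>
      \<bar>(LINT x|\<nu>. min \<bar>x\<bar> K) - (LINT x|?N. min \<bar>x\<bar> K)\<bar> \<le> \<epsilon> / 2"
    using clt_weights_bounded[OF c] by blast
  show thesis
  proof (rule that[of "min \<delta> 1"])
    fix k a \<nu>
    assume \<nu>: "real_distribution \<nu>" "\<And>t. char \<nu> t = (\<Prod>i<k. char \<mu> (a i * t))"
      "integrable \<nu> (\<lambda>x. x\<^sup>2)" "(LINT x|\<nu>. x\<^sup>2) = (\<Sum>i<k. (a i)\<^sup>2)"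
      and a: "nearly_normal_weights (min \<delta> 1) k a"
    have "\<bar>(LINT x|\<nu>. min \<bar>x\<bar> K) - (LINT x|?N. min \<bar>x\<bar> K)\<bar> \<le> \<epsilon> / 2"
      using a by (intro \<delta>(2)[OF \<nu>(1,2)]) (auto simp: nearly_normal_weights_def)
    moreover have "\<bar>(LINT x|\<nu>. \<bar>x\<bar>) - (LINT x|\<nu>. min \<bar>x\<bar> K)\<bar> \<le> 2 / K"
      using tail[OF \<nu>(1,3)] a K unfolding \<nu>(4) nearly_normal_weights_def
      by (elim order_trans) (auto intro!: divide_right_mono)
    moreover have "\<bar>sqrt (2 / pi) - (LINT x|?N. min \<bar>x\<bar> K)\<bar> \<le> 1 / K"
      using tail[OF real_dist_normal_dist std_normal.square_integrable]
      unfolding std_normal.second_moment Nabs .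
    moreover have "2 / K + 1 / K = \<epsilon> / 2" unfolding K_def by simp
    ultimately show "\<bar>(LINT x|\<nu>. \<bar>x\<bar>) - sqrt (2 / pi)\<bar> \<le> \<epsilon>" by linarith
  qed (use \<delta>(1) in auto)
qed

text \<open>Uniform integrability of the squares, obtained by subtraction: the full second moment is
  close to 1, and so is the truncated one, because it is close to that of the normal law for a large
  fixed \<open>K\<close>.\<close>

lemma clt_weights_square_tail:
  assumes "\<epsilon> > 0"
  obtains \<delta> K where "\<delta> > 0" "K > 0"
    "\<And>k a \<nu>. real_distribution \<nu> \<Longrightarrow> (\<And>t. char \<nu> t = (\<Prod>i<k. char \<mu> (a i * t))) \<Longrightarrow>
      integrable \<nu> (\<lambda>x. x\<^sup>2) \<Longrightarrow> (LINT x|\<nu>. x\<^sup>2) = (\<Sum>i<k. (a i)\<^sup>2) \<Longrightarrow>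
      nearly_normal_weights \<delta> k a \<Longrightarrow> (LINT x|\<nu>. x\<^sup>2 - min (x\<^sup>2) K) \<le> \<epsilon>"
proof -
  let ?N = std_normal_distribution
  have "(\<lambda>n. LINT x|?N. min (x\<^sup>2) (real (Suc n))) \<longlonglongrightarrow> (LINT x|?N. x\<^sup>2)"
  proof (rule integral_dominated_convergence[where w = "\<lambda>x. x\<^sup>2"])
    have "(\<lambda>n. min (x\<^sup>2) (real (Suc n))) \<longlonglongrightarrow> x\<^sup>2" for x :: real
    proof (rule tendsto_eventually)
      obtain m :: nat where "x\<^sup>2 \<le> real m" using real_arch_simple by blast
      thus "\<forall>\<^sub>F n in sequentially. min (x\<^sup>2) (real (Suc n)) = x\<^sup>2"
        by (intro eventually_sequentiallyI[of m]) (simp add: min_def)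
    qed
    thus "AE x in ?N. (\<lambda>n. min (x\<^sup>2) (real (Suc n))) \<longlonglongrightarrow> x\<^sup>2" by simp
  qed (use std_normal.square_integrable in auto)
  then obtain n where n: "\<bar>(LINT x|?N. min (x\<^sup>2) (real (Suc n))) - 1\<bar> < \<epsilon> / 3"
    using assms unfolding std_normal.second_moment
    by (metis LIMSEQ_D divide_pos_pos order_refl real_norm_def zero_less_numeral)
  define K where "K = real (Suc n)"
  have K: "K > 0" unfolding K_def by simp
  have c: "isCont (\<lambda>x. min (x\<^sup>2) K) x" "\<bar>min (x\<^sup>2) K\<bar> \<le> K" "\<epsilon> / 3 > 0" for x :: real
  proof -
    show "isCont (\<lambda>x. min (x\<^sup>2) K) x" by (intro continuous_intros)
  qed (use K assms in \<open>auto simp: min_def\<close>)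
  obtain \<delta> where \<delta>: "\<delta> > 0"
    "\<And>k a \<nu>. real_distribution \<nu> \<Longrightarrow> (\<And>t. char \<nu> t = (\<Prod>i<k. char \<mu> (a i * t))) \<Longrightarrow>
      \<bar>(\<Sum>i<k. (a i)\<^sup>2) - 1\<bar> \<le> \<delta> \<Longrightarrow> (\<And>i. i < (k::nat) \<Longrightarrow> \<bar>a i\<bar> \<le> \<delta>) \<Longrightarrow>
      \<bar>(LINT x|\<nu>. min (x\<^sup>2) K) - (LINT x|?N. min (x\<^sup>2) K)\<bar> \<le> \<epsilon> / 3"
    using clt_weights_bounded[OF c] by blast
  \<comment> \<open>One third of \<open>\<epsilon>\<close> each pays for the deviation of the second
    moment from 1, for the bounded comparison, and for the truncation of the normal second
    moment.\<close>
  show thesis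
  proof (rule that[of "min \<delta> (\<epsilon> / 3)" K])
    fix k a \<nu>
    assume \<nu>: "real_distribution \<nu>" "\<And>t. char \<nu> t = (\<Prod>i<k. char \<mu> (a i * t))"
      "integrable \<nu> (\<lambda>x. x\<^sup>2)" "(LINT x|\<nu>. x\<^sup>2) = (\<Sum>i<k. (a i)\<^sup>2)"
      and a: "nearly_normal_weights (min \<delta> (\<epsilon> / 3)) k a"
    interpret \<nu>: real_distribution \<nu> by fact
    have "\<bar>(LINT x|\<nu>. min (x\<^sup>2) K) - (LINT x|?N. min (x\<^sup>2) K)\<bar> \<le> \<epsilon> / 3"
      using a by (intro \<delta>(2)[OF \<nu>(1,2)]) (auto simp: nearly_normal_weights_def)
    moreover have "(LINT x|\<nu>. x\<^sup>2 - min (x\<^sup>2) K) = (\<Sum>i<k. (a i)\<^sup>2) - (LINT x|\<nu>. min (x\<^sup>2) K)"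
      using \<nu>(3) by (simp add: Bochner_Integration.integral_diff \<nu>(4))
    moreover have "(\<Sum>i<k. (a i)\<^sup>2) \<le> 1 + \<epsilon> / 3"
      using a unfolding nearly_normal_weights_def by linarith
    ultimately show "(LINT x|\<nu>. x\<^sup>2 - min (x\<^sup>2) K) \<le> \<epsilon>"
      using n unfolding K_def by linarith
  qed (use \<delta>(1) K assms in auto)
qed

end

section \<open>Multiplication by one random factor\<close>

context prob_space
begin

text \<open>The cross term vanishes because a centered summand is independent of the sum of the
  others. Integrability is part of the conclusion so that it is available in the induction.\<close>

lemma indep_vars_second_moment_sum:
  fixes Y :: "'i \<Rightarrow> 'a \<Rightarrow> real"
  assumes "finite I" "indep_vars (\<lambda>_. borel) Y I"
    and "\<And>i. i \<in> I \<Longrightarrow> integrable M (\<lambda>\<omega>. (Y i \<omega>)\<^sup>2)" "\<And>i. i \<in> I \<Longrightarrow> expectation (Y i) = 0"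
  shows "integrable M (\<lambda>\<omega>. (\<Sum>i\<in>I. Y i \<omega>)\<^sup>2) \<and>
    expectation (\<lambda>\<omega>. (\<Sum>i\<in>I. Y i \<omega>)\<^sup>2) = (\<Sum>i\<in>I. expectation (\<lambda>\<omega>. (Y i \<omega>)\<^sup>2))"
  using assms
proof (induction I rule: finite_induct)
  case (insert i I)
  let ?S = "\<lambda>\<omega>. \<Sum>i\<in>I. Y i \<omega>"
  have rv: "random_variable borel (Y j)" if "j \<in> insert i I" for j
    using insert.prems(1) that by (auto simp: indep_vars_def)
  have int: "integrable M (Y j)" if "j \<in> insert i I" for j
    by (rule square_integrable_imp_integrable) (use rv insert.prems(2) that in auto)
  have S: "integrable M (\<lambda>\<omega>. (?S \<omega>)\<^sup>2)"
    "expectation (\<lambda>\<omega>. (?S \<omega>)\<^sup>2) = (\<Sum>i\<in>I. expectation (\<lambda>\<omega>. (Y i \<omega>)\<^sup>2))"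
    using insert.IH insert.prems indep_vars_subset[OF insert.prems(1)] by auto
  have intS: "integrable M ?S" using int by auto
  have ind: "indep_var borel (Y i) borel ?S"
    using insert by (intro indep_vars_sum) auto
  have cross: "expectation (\<lambda>\<omega>. Y i \<omega> * ?S \<omega>) = 0" "integrable M (\<lambda>\<omega>. Y i \<omega> * ?S \<omega>)"
    using indep_var_lebesgue_integral[OF ind int intS] indep_var_integrable[OF ind int intS]
      insert.prems(3)[of i] by auto
  have sq: "(\<lambda>\<omega>. (\<Sum>i\<in>insert i I. Y i \<omega>)\<^sup>2) = (\<lambda>\<omega>. (Y i \<omega>)\<^sup>2 + (2 * (Y i \<omega> * ?S \<omega>) + (?S \<omega>)\<^sup>2))"
    using insert.hyps by (simp add: power2_sum algebra_simps)
  have intY: "integrable M (\<lambda>\<omega>. (Y i \<omega>)\<^sup>2)" using insert.prems(2) by simp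
  show ?case unfolding sq
    using S cross intY insert.hyps by simp
qed simp

text \<open>Chebyshev's inequality for variables whose means are only near \<open>s\<close>: this
  bias uses up \<open>\<epsilon> / 2\<close>, and the centered sum must account for the other half,
  whence the factor 4.\<close>

lemma weak_law_indep:
  fixes Y :: "nat \<Rightarrow> 'a \<Rightarrow> real"
  assumes ind: "indep_vars (\<lambda>_. borel) Y {..<n}" and "n > 0" "\<epsilon> > 0"
    and int: "\<And>j. j < n \<Longrightarrow> integrable M (\<lambda>\<omega>. (Y j \<omega>)\<^sup>2)"
    and sq: "\<And>j. j < n \<Longrightarrow> expectation (\<lambda>\<omega>. (Y j \<omega>)\<^sup>2) \<le> c"
    and mean: "\<And>j. j < n \<Longrightarrow> \<bar>expectation (Y j) - s\<bar> \<le> \<epsilon> / 2"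
  shows "prob {\<omega> \<in> space M. \<bar>(\<Sum>j<n. Y j \<omega>) / n - s\<bar> \<ge> \<epsilon>} \<le> 4 * c / (n * \<epsilon>\<^sup>2)"
proof -
  have rv: "random_variable borel (Y j)" if "j < n" for j
    using ind that by (auto simp: indep_vars_def)
  have int1: "integrable M (Y j)" if "j < n" for j
    by (rule square_integrable_imp_integrable) (use rv int that in auto)
  define Z where "Z j \<omega> = Y j \<omega> - expectation (Y j)" for j \<omega>
  have Zind: "indep_vars (\<lambda>_. borel) Z {..<n}"
    unfolding Z_def by (rule indep_vars_compose2[OF ind]) simp
  have Z0: "expectation (Z j) = 0" if "j < n" for j
    unfolding Z_def using int1[OF that] by (simp add: prob_space)
  have Zeq: "(\<lambda>\<omega>. (Z j \<omega>)\<^sup>2) = (\<lambda>\<omega>. (Y j \<omega>)\<^sup>2 - 2 * expectation (Y j) * Y j \<omega> + (expectation (Y j))\<^sup>2)" for j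
    unfolding Z_def by (simp add: power2_diff algebra_simps)
  have Zint: "integrable M (\<lambda>\<omega>. (Z j \<omega>)\<^sup>2)" if "j < n" for j
    unfolding Zeq using int int1 that by auto
  have Zsq: "expectation (\<lambda>\<omega>. (Z j \<omega>)\<^sup>2) \<le> c" if "j < n" for j
  proof -
    have "expectation (\<lambda>\<omega>. (Z j \<omega>)\<^sup>2) = expectation (\<lambda>\<omega>. (Y j \<omega>)\<^sup>2) - (expectation (Y j))\<^sup>2"
      unfolding Z_def using variance_eq[OF int1 int] that by simp
    thus ?thesis using sq[OF that] by (smt (verit) zero_le_power2)
  qed
  have sum: "integrable M (\<lambda>\<omega>. (\<Sum>j<n. Z j \<omega>)\<^sup>2)"
    "expectation (\<lambda>\<omega>. (\<Sum>j<n. Z j \<omega>)\<^sup>2) = (\<Sum>j<n. expectation (\<lambda>\<omega>. (Z j \<omega>)\<^sup>2))"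
    using indep_vars_second_moment_sum[OF _ Zind] Zint Z0 by auto
  have "{\<omega> \<in> space M. \<bar>(\<Sum>j<n. Y j \<omega>) / n - s\<bar> \<ge> \<epsilon>} \<subseteq>
      {\<omega> \<in> space M. (\<Sum>j<n. Z j \<omega>)\<^sup>2 \<ge> (n * \<epsilon> / 2)\<^sup>2}"
  proof safe
    fix \<omega> assume *: "\<epsilon> \<le> \<bar>(\<Sum>j<n. Y j \<omega>) / n - s\<bar>"
    have "\<bar>\<Sum>j<n. expectation (Y j) - s\<bar> \<le> (\<Sum>j<n. \<epsilon> / 2)"
      by (rule order_trans[OF sum_abs sum_mono]) (use mean in auto)
    moreover have "(\<Sum>j<n. Y j \<omega>) - n * s = (\<Sum>j<n. Z j \<omega>) + (\<Sum>j<n. expectation (Y j) - s)"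
      unfolding Z_def by (simp add: sum_subtractf)
    moreover have "n * \<epsilon> \<le> \<bar>(\<Sum>j<n. Y j \<omega>) - n * s\<bar>"
    proof -
      have "n * \<epsilon> \<le> n * \<bar>(\<Sum>j<n. Y j \<omega>) / n - s\<bar>" using * by (intro mult_left_mono) auto
      also have "\<dots> = \<bar>n * ((\<Sum>j<n. Y j \<omega>) / n - s)\<bar>" by (simp add: abs_mult)
      finally show ?thesis using \<open>n > 0\<close> by (simp add: right_diff_distrib)
    qed
    ultimately have "n * \<epsilon> / 2 \<le> \<bar>\<Sum>j<n. Z j \<omega>\<bar>" by simp
    thus "(n * \<epsilon> / 2)\<^sup>2 \<le> (\<Sum>j<n. Z j \<omega>)\<^sup>2"
      using \<open>\<epsilon> > 0\<close> by (subst power2_abs[symmetric, of "\<Sum>j<n. Z j \<omega>"]) (intro power_mono, auto)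
  qed
  hence "prob {\<omega> \<in> space M. \<bar>(\<Sum>j<n. Y j \<omega>) / n - s\<bar> \<ge> \<epsilon>} \<le>
      prob {\<omega> \<in> space M. (\<Sum>j<n. Z j \<omega>)\<^sup>2 \<ge> (n * \<epsilon> / 2)\<^sup>2}"
    by (rule finite_measure_mono) (use sum(1) in measurable)
  also have "\<dots> \<le> expectation (\<lambda>\<omega>. (\<Sum>j<n. Z j \<omega>)\<^sup>2) / (n * \<epsilon> / 2)\<^sup>2"
    using assms(2,3) by (intro integral_Markov_inequality_measure[where A = "{}"] sum(1)) auto
  also have "\<dots> \<le> (n * c) / (n * \<epsilon> / 2)\<^sup>2"
    unfolding sum(2) using sum_mono[of "{..<n}", OF Zsq] by (intro divide_right_mono) auto
  also have "\<dots> = 4 * c / (n * \<epsilon>\<^sup>2)"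
    using assms(2,3) by (simp add: field_simps power2_eq_square)
  finally show ?thesis .
qed

end

section \<open>A deterministic row vector times one random matrix\<close>

context standardized_law
begin

text \<open>Gathers, for a fixed row vector \<open>a\<close>, the inputs of the central limit
  theorem and of the weak law. Distinct entries of the product use disjoint columns of
  \<open>B\<close>, hence their independence.\<close>

lemma iid_column_combination:
  fixes M :: "'w measure" and a :: "nat \<Rightarrow> real"
  assumes "prob_space M" and iid: "iid_entries M B k n \<mu>"
  defines "w \<equiv> \<lambda>j \<omega>. \<Sum>i<k. a i * B \<omega> $$ (i, j)"
  shows "prob_space.indep_vars M (\<lambda>_. borel) w {..<n}"
    and "j < n \<Longrightarrow> w j \<in> borel_measurable M"
    and "j < n \<Longrightarrow> char (distr M borel (w j)) t = (\<Prod>i<k. char \<mu> (a i * t))"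
    and "j < n \<Longrightarrow> integrable M (\<lambda>\<omega>. (w j \<omega>)\<^sup>2)"
    and "j < n \<Longrightarrow> (LINT \<omega>|M. (w j \<omega>)\<^sup>2) = (\<Sum>i<k. (a i)\<^sup>2)"
proof -
  interpret M: prob_space M by fact
  let ?X = "\<lambda>(i, j) \<omega>. B \<omega> $$ (i, j)"
  have ind: "M.indep_vars (\<lambda>_. borel) ?X ({..<k} \<times> {..<n})"
    and law: "\<And>i j. i < k \<Longrightarrow> j < n \<Longrightarrow> distr M borel (\<lambda>\<omega>. B \<omega> $$ (i, j)) = \<mu>"
    using iid unfolding iid_entries_def by auto
  have rv: "M.random_variable borel (\<lambda>\<omega>. B \<omega> $$ (i, j))" if "i < k" "j < n" for i j
    using ind that by (auto simp: M.indep_vars_def)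
  \<comment> \<open>Independence is first passed to blocks, one per column, and each block is then
    mapped to its linear combination.\<close>
  have "M.indep_vars (\<lambda>j. PiM ({..<k} \<times> {j}) (\<lambda>_. borel))
      (\<lambda>j \<omega>. restrict (\<lambda>p. ?X p \<omega>) ({..<k} \<times> {j})) {..<n}"
    by (rule M.indep_vars_restrict[OF ind]) (auto simp: disjoint_family_on_def)
  hence "M.indep_vars (\<lambda>_. borel)
      (\<lambda>j \<omega>. (\<lambda>f. \<Sum>i<k. a i * f (i, j)) (restrict (\<lambda>p. ?X p \<omega>) ({..<k} \<times> {j}))) {..<n}"
    by (rule M.indep_vars_compose2) (intro borel_measurable_sum borel_measurable_times
        borel_measurable_const measurable_component_singleton, auto)
  thus *: "M.indep_vars (\<lambda>_. borel) w {..<n}"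
    unfolding w_def by (rule M.indep_vars_cong[THEN iffD1, rotated -1]) auto
  assume j: "j < n"
  show wj: "w j \<in> borel_measurable M" using * j by (auto simp: M.indep_vars_def)
  have "M.indep_vars (\<lambda>_. borel) (\<lambda>i. ?X (i, j)) {..<k}"
  proof -
    \<comment> \<open>Singleton blocks serve to reindex a single column from pairs
      \<open>(i, j)\<close> to \<open>i\<close>.\<close>
    have "M.indep_vars (\<lambda>i. PiM {(i, j)} (\<lambda>_. borel))
        (\<lambda>i \<omega>. restrict (\<lambda>p. ?X p \<omega>) {(i, j)}) {..<k}"
      by (rule M.indep_vars_restrict[OF ind]) (use j in \<open>auto simp: disjoint_family_on_def\<close>)
    hence "M.indep_vars (\<lambda>_. borel)
        (\<lambda>i \<omega>. (\<lambda>f. f (i, j)) (restrict (\<lambda>p. ?X p \<omega>) {(i, j)})) {..<k}"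
      by (rule M.indep_vars_compose2) (intro measurable_component_singleton, auto)
    thus ?thesis by simp
  qed
  hence indi: "M.indep_vars (\<lambda>_. borel) (\<lambda>i \<omega>. a i * B \<omega> $$ (i, j)) {..<k}"
    using M.indep_vars_compose2[of "\<lambda>_. borel" _ "{..<k}" "\<lambda>i x. a i * x" "\<lambda>_. borel"] by simp
  have "char (distr M borel (w j)) t = (\<Prod>i<k. char (distr M borel (\<lambda>\<omega>. a i * B \<omega> $$ (i, j))) t)"
    unfolding w_def by (rule M.char_distr_sum[OF indi])
  also have "\<dots> = (\<Prod>i<k. char \<mu> (a i * t))"
  proof (rule prod.cong)
    fix i assume "i \<in> {..<k}"
    hence i: "i < k" by simp
    note [measurable] = rv[OF i j]
    show "char (distr M borel (\<lambda>\<omega>. a i * B \<omega> $$ (i, j))) t = char \<mu> (a i * t)"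
      unfolding char_def law[OF i j, symmetric] by (simp add: integral_distr mult_ac)
  qed simp
  finally show "char (distr M borel (w j)) t = (\<Prod>i<k. char \<mu> (a i * t))" .
  have sq: "integrable M (\<lambda>\<omega>. (a i * B \<omega> $$ (i, j))\<^sup>2)"
    "(LINT \<omega>|M. (a i * B \<omega> $$ (i, j))\<^sup>2) = (a i)\<^sup>2"
    "(LINT \<omega>|M. a i * B \<omega> $$ (i, j)) = 0" if i: "i < k" for i
  proof -
    note [measurable] = rv[OF i j]
    have "integrable M (\<lambda>\<omega>. (B \<omega> $$ (i, j))\<^sup>2)" "(LINT \<omega>|M. (B \<omega> $$ (i, j))\<^sup>2) = 1"
      "(LINT \<omega>|M. B \<omega> $$ (i, j)) = 0"
      using square_integrable second_moment mean_zero unfolding law[OF i j, symmetric]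
      by (simp_all add: integrable_distr_eq integral_distr)
    thus "integrable M (\<lambda>\<omega>. (a i * B \<omega> $$ (i, j))\<^sup>2)"
      "(LINT \<omega>|M. (a i * B \<omega> $$ (i, j))\<^sup>2) = (a i)\<^sup>2"
      "(LINT \<omega>|M. a i * B \<omega> $$ (i, j)) = 0"
      by (simp_all add: power_mult_distrib)
  qed
  show "integrable M (\<lambda>\<omega>. (w j \<omega>)\<^sup>2)" "(LINT \<omega>|M. (w j \<omega>)\<^sup>2) = (\<Sum>i<k. (a i)\<^sup>2)"
    using M.indep_vars_second_moment_sum[OF _ indi] sq unfolding w_def by auto
qed

text \<open>The central limit theorem puts each mean of \<open>\<bar>w j\<bar>\<close> within
  \<open>\<epsilon> / 2\<close> of \<open>sqrt (2 / pi)\<close>, and the weak law does the rest with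
  second moments at most 2. The constants are fixed before the probability space, the sizes and the
  weights.\<close>

lemma layer_abs_mean:
  assumes "\<epsilon> > 0"
  obtains \<delta> N where "\<delta> > 0"
    "\<And>(M :: 'w measure) B k n a. prob_space M \<Longrightarrow> iid_entries M B k n \<mu> \<Longrightarrow>
      nearly_normal_weights \<delta> k a \<Longrightarrow> N \<le> n \<Longrightarrow>
      measure M {\<omega> \<in> space M. \<bar>(\<Sum>j<n. \<bar>\<Sum>i<k. a i * B \<omega> $$ (i, j)\<bar>) / n - sqrt (2 / pi)\<bar> \<ge> \<epsilon>} \<le> \<epsilon>"
proof -
  have "\<epsilon> / 2 > 0" using assms by simp
  then obtain \<delta> where \<delta>: "\<delta> > 0"
    "\<And>k a \<nu>. real_distribution \<nu> \<Longrightarrow> (\<And>t. char \<nu> t = (\<Prod>i<k. char \<mu> (a i * t))) \<Longrightarrow>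
      integrable \<nu> (\<lambda>x. x\<^sup>2) \<Longrightarrow> (LINT x|\<nu>. x\<^sup>2) = (\<Sum>i<k. (a i)\<^sup>2) \<Longrightarrow>
      nearly_normal_weights \<delta> k a \<Longrightarrow> \<bar>(LINT x|\<nu>. \<bar>x\<bar>) - sqrt (2 / pi)\<bar> \<le> \<epsilon> / 2"
    using clt_weights_abs by blast
  \<comment> \<open>Makes the weak-law bound \<open>4 * 2 / (n * \<epsilon>\<^sup>2)\<close> at most
    \<open>\<epsilon>\<close>, and \<open>n\<close> positive.\<close>
  define N where "N = Suc (nat \<lceil>8 / (\<epsilon>\<^sup>2 * \<epsilon>)\<rceil>)"
  show thesis
  proof (rule that[of "min \<delta> 1" N])
    fix M :: "'w measure" and B k n a
    assume M: "prob_space M" and iid: "iid_entries M B k n \<mu>"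
      and a: "nearly_normal_weights (min \<delta> 1) k a" and n: "N \<le> n"
    interpret M: prob_space M by fact
    define w where "w j \<omega> = (\<Sum>i<k. a i * B \<omega> $$ (i, j))" for j \<omega>
    note w = iid_column_combination[OF M iid, where a = a, folded w_def]
    have n0: "n > 0" using n unfolding N_def by simp
    have "M.prob {\<omega> \<in> space M. \<bar>(\<Sum>j<n. \<bar>w j \<omega>\<bar>) / n - sqrt (2 / pi)\<bar> \<ge> \<epsilon>} \<le> 4 * 2 / (n * \<epsilon>\<^sup>2)"
    proof (rule M.weak_law_indep[OF _ n0 assms])
      show "M.indep_vars (\<lambda>_. borel) (\<lambda>j \<omega>. \<bar>w j \<omega>\<bar>) {..<n}"
        by (rule M.indep_vars_compose2[OF w(1)]) simp
      fix j assume j: "j < n"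
      note [measurable] = w(2)[OF j]
      show "integrable M (\<lambda>\<omega>. \<bar>w j \<omega>\<bar>\<^sup>2)" using w(4)[OF j] by simp
      show "M.expectation (\<lambda>\<omega>. \<bar>w j \<omega>\<bar>\<^sup>2) \<le> 2"
        using w(5)[OF j] a unfolding nearly_normal_weights_def by auto
      have "\<bar>(LINT x|distr M borel (w j). \<bar>x\<bar>) - sqrt (2 / pi)\<bar> \<le> \<epsilon> / 2"
      proof (rule \<delta>(2))
        show "real_distribution (distr M borel (w j))"
          by (rule M.real_distribution_distr) measurable
        show "nearly_normal_weights \<delta> k a" using a by (rule nearly_normal_weights_mono) simp
      qed (use w(3-5)[OF j] in \<open>simp_all add: integrable_distr_eq integral_distr\<close>)
      thus "\<bar>M.expectation (\<lambda>\<omega>. \<bar>w j \<omega>\<bar>) - sqrt (2 / pi)\<bar> \<le> \<epsilon> / 2"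
        by (simp add: integral_distr)
    qed
    also have "\<dots> \<le> \<epsilon>"
    proof -
      have "8 / (\<epsilon>\<^sup>2 * \<epsilon>) \<le> n" using n unfolding N_def by linarith
      thus ?thesis using assms n0 by (simp add: field_simps)
    qed
    finally show "M.prob {\<omega> \<in> space M.
      \<bar>(\<Sum>j<n. \<bar>\<Sum>i<k. a i * B \<omega> $$ (i, j)\<bar>) / n - sqrt (2 / pi)\<bar> \<ge> \<epsilon>} \<le> \<epsilon>"
      unfolding w_def .
  qed (use \<delta>(1) in auto)
qed

text \<open>Splitting \<open>x\<^sup>2 = min (x\<^sup>2) K + (x\<^sup>2 - min (x\<^sup>2) K)\<close>, the first part obeys the weak law and the second
  is small in mean; the second part also controls the largest weight, since it is at least
  \<open>x\<^sup>2 / 2\<close> as soon as \<open>x\<^sup>2 \<ge> 2 * K\<close>.\<close>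

lemma layer_nearly_normal:
  assumes "\<epsilon> > 0"
  obtains \<delta> N where "\<delta> > 0"
    "\<And>(M :: 'w measure) B k n a. prob_space M \<Longrightarrow> iid_entries M B k n \<mu> \<Longrightarrow>
      nearly_normal_weights \<delta> k a \<Longrightarrow> N \<le> n \<Longrightarrow>
      measure M {\<omega> \<in> space M.
        \<not> nearly_normal_weights \<epsilon> n (\<lambda>j. (\<Sum>i<k. a i * B \<omega> $$ (i, j)) / sqrt n)} \<le> \<epsilon>"
proof -
  \<comment> \<open>\<open>\<theta>\<close> bounds the average of the tails:
    \<open>\<epsilon> / 2\<close> is what the square sum tolerates, and
    \<open>\<epsilon>\<^sup>2 / 2\<close> keeps a single square below
    \<open>n * \<epsilon>\<^sup>2\<close>.\<close>
  define \<theta> where "\<theta> = min (\<epsilon> / 2) (\<epsilon>\<^sup>2 / 2)"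
  \<comment> \<open>\<open>\<eta>\<close> bounds the mean of one tail. Markov's inequality then
    gives \<open>\<eta> / \<theta>\<close>, at most \<open>\<epsilon> / 2\<close>; and
    \<open>\<epsilon> / 8\<close>, added to the same tolerance on the square sum of
    \<open>a\<close>, keeps the truncated mean within \<open>\<epsilon> / 4\<close> of 1.\<close>
  define \<eta> where "\<eta> = min (\<theta> * \<epsilon> / 2) (\<epsilon> / 8)"
  have \<theta>: "\<theta> > 0" "\<theta> \<le> \<epsilon> / 2" "\<theta> \<le> \<epsilon>\<^sup>2 / 2" using assms unfolding \<theta>_def by auto
  have \<eta>: "\<eta> > 0" "\<eta> \<le> \<theta> * \<epsilon> / 2" "\<eta> \<le> \<epsilon> / 8" using assms \<theta> unfolding \<eta>_def by auto
  obtain \<delta> K where \<delta>: "\<delta> > 0" and K: "K > 0" and tail: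
    "\<And>k a \<nu>. real_distribution \<nu> \<Longrightarrow> (\<And>t. char \<nu> t = (\<Prod>i<k. char \<mu> (a i * t))) \<Longrightarrow>
      integrable \<nu> (\<lambda>x. x\<^sup>2) \<Longrightarrow> (LINT x|\<nu>. x\<^sup>2) = (\<Sum>i<k. (a i)\<^sup>2) \<Longrightarrow>
      nearly_normal_weights \<delta> k a \<Longrightarrow> (LINT x|\<nu>. x\<^sup>2 - min (x\<^sup>2) K) \<le> \<eta>"
    using clt_weights_square_tail[OF \<eta>(1)] by blast
  \<comment> \<open>The first bound makes the weak-law probability for variables bounded by
    \<open>K\<close> at most \<open>\<epsilon> / 2\<close>; the second gives
    \<open>2 * K \<le> n * \<epsilon>\<^sup>2\<close>, which settles the entries with
    \<open>(w j \<omega>)\<^sup>2 \<le> 2 * K\<close>.\<close>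
  define C where "C = max (32 * K\<^sup>2 / (\<epsilon>\<^sup>2 * \<epsilon>)) (2 * K / \<epsilon>\<^sup>2)"
  define N where "N = Suc (nat \<lceil>C\<rceil>)"
  show thesis
  proof (rule that[of "min \<delta> (\<epsilon> / 8)" N])
    fix M :: "'w measure" and B k n a
    assume M: "prob_space M" and iid: "iid_entries M B k n \<mu>"
      and a: "nearly_normal_weights (min \<delta> (\<epsilon> / 8)) k a" and n: "N \<le> n"
    interpret M: prob_space M by fact
    define w where "w j \<omega> = (\<Sum>i<k. a i * B \<omega> $$ (i, j))" for j \<omega>
    note w = iid_column_combination[OF M iid, where a = a, folded w_def]
    have n0: "n > 0" and nC: "C \<le> n" using n unfolding N_def by (simp, linarith)
    define S where "S j \<omega> = min ((w j \<omega>)\<^sup>2) K" for j \<omega>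
    define T where "T j \<omega> = (w j \<omega>)\<^sup>2 - S j \<omega>" for j \<omega>
    have S0: "0 \<le> S j \<omega>" "S j \<omega> \<le> K" and T0: "0 \<le> T j \<omega>" for j \<omega>
      unfolding S_def T_def using K by auto
    have S_rv: "S j \<in> borel_measurable M" if "j < n" for j
      unfolding S_def using w(2)[OF that] by measurable
    have S_int: "integrable M (S j)" if "j < n" for j
      by (rule M.integrable_const_bound[of _ K]) (use S0 in simp, rule S_rv[OF that])
    have T_int: "integrable M (T j)" if "j < n" for j
      unfolding T_def using w(4)[OF that] S_int[OF that] by (intro Bochner_Integration.integrable_diff)
    have ET: "M.expectation (T j) \<le> \<eta>" if j: "j < n" for j
    proof -
      note [measurable] = w(2)[OF j]
      have "(LINT x|distr M borel (w j). x\<^sup>2 - min (x\<^sup>2) K) \<le> \<eta>"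
      proof (rule tail)
        show "real_distribution (distr M borel (w j))"
          by (rule M.real_distribution_distr) measurable
        show "nearly_normal_weights \<delta> k a" using a by (rule nearly_normal_weights_mono) simp
      qed (use w(3-5)[OF j] in \<open>simp_all add: integrable_distr_eq integral_distr\<close>)
      thus ?thesis by (simp add: integral_distr T_def[abs_def] S_def)
    qed
    have ET0: "0 \<le> M.expectation (T j)" for j
      by (rule Bochner_Integration.integral_nonneg) (rule T0)
    have ES: "\<bar>M.expectation (S j) - 1\<bar> \<le> \<epsilon> / 2 / 2" if j: "j < n" for j
    proof -
      have "M.expectation (T j) = (\<Sum>i<k. (a i)\<^sup>2) - M.expectation (S j)"
        unfolding T_def using w(4,5)[OF j] S_int[OF j] by (simp add: Bochner_Integration.integral_diff)
      moreover have "\<bar>(\<Sum>i<k. (a i)\<^sup>2) - 1\<bar> \<le> \<epsilon> / 8"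
        using a unfolding nearly_normal_weights_def by simp
      ultimately show ?thesis using ET[OF j] ET0[of j] \<eta>(3) by linarith
    qed
    \<comment> \<open>\<open>U\<close> is the failure of the weak law for the truncated squares,
      \<open>V\<close> that of the tail bound; each gets probability at most
      \<open>\<epsilon> / 2\<close>, and outside both the new row is good.\<close>
    define U where "U = {\<omega> \<in> space M. \<bar>(\<Sum>j<n. S j \<omega>) / n - 1\<bar> \<ge> \<epsilon> / 2}"
    define V where "V = {\<omega> \<in> space M. (\<Sum>j<n. T j \<omega>) \<ge> n * \<theta>}"
    have U_meas: "U \<in> M.events" unfolding U_def using S_rv by measurable
    have V_meas: "V \<in> M.events"
      unfolding V_def using T_int[THEN borel_measurable_integrable] by measurable
    have "M.prob U \<le> 4 * K\<^sup>2 / (n * (\<epsilon> / 2)\<^sup>2)"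
      unfolding U_def
    proof (rule M.weak_law_indep[OF _ n0])
      show "M.indep_vars (\<lambda>_. borel) S {..<n}"
        unfolding S_def by (rule M.indep_vars_compose2[OF w(1)]) simp
      fix j assume j: "j < n"
      have le: "(S j \<omega>)\<^sup>2 \<le> K\<^sup>2" for \<omega> using S0 by (intro power_mono)
      show *: "integrable M (\<lambda>\<omega>. (S j \<omega>)\<^sup>2)"
      proof (rule M.integrable_const_bound[of _ "K\<^sup>2"])
        show "(\<lambda>\<omega>. (S j \<omega>)\<^sup>2) \<in> borel_measurable M" using S_rv[OF j] by measurable
      qed (use le in simp)
      have "M.expectation (\<lambda>\<omega>. (S j \<omega>)\<^sup>2) \<le> M.expectation (\<lambda>_. K\<^sup>2)"
        by (rule integral_mono[OF * _ le]) simp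
      thus "M.expectation (\<lambda>\<omega>. (S j \<omega>)\<^sup>2) \<le> K\<^sup>2" by (simp add: M.prob_space)
      show "\<bar>M.expectation (S j) - 1\<bar> \<le> \<epsilon> / 2 / 2" by (rule ES[OF j])
    next
      show "\<epsilon> / 2 > 0" using assms by simp
    qed
    also have "\<dots> \<le> \<epsilon> / 2"
    proof -
      have "32 * K\<^sup>2 / (\<epsilon>\<^sup>2 * \<epsilon>) \<le> n" using nC unfolding C_def by simp
      thus ?thesis using assms n0 by (simp add: field_simps power2_eq_square)
    qed
    finally have PU: "M.prob U \<le> \<epsilon> / 2" .
    have sumT_int: "integrable M (\<lambda>\<omega>. \<Sum>j<n. T j \<omega>)" using T_int by auto
    have "M.prob V \<le> M.expectation (\<lambda>\<omega>. \<Sum>j<n. T j \<omega>) / (n * \<theta>)"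
      unfolding V_def using n0 \<theta>(1) T0
      by (intro integral_Markov_inequality_measure[where A = "{}"] sumT_int) (auto intro!: sum_nonneg)
    also have "M.expectation (\<lambda>\<omega>. \<Sum>j<n. T j \<omega>) = (\<Sum>j<n. M.expectation (T j))"
      using T_int by (intro Bochner_Integration.integral_sum) auto
    also have "(\<Sum>j<n. M.expectation (T j)) / (n * \<theta>) \<le> (n * \<eta>) / (n * \<theta>)"
      using sum_mono[of "{..<n}", OF ET] \<theta>(1) by (intro divide_right_mono) auto
    also have "\<dots> \<le> \<epsilon> / 2"
      using \<eta>(2) \<theta>(1) n0 by (simp add: field_simps)
    finally have PV: "M.prob V \<le> \<epsilon> / 2" .
    have "{\<omega> \<in> space M. \<not> nearly_normal_weights \<epsilon> n (\<lambda>j. w j \<omega> / sqrt n)} \<subseteq> U \<union> V"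
    proof (rule subsetI, rule ccontr)
      fix \<omega> assume \<omega>: "\<omega> \<in> {\<omega> \<in> space M. \<not> nearly_normal_weights \<epsilon> n (\<lambda>j. w j \<omega> / sqrt n)}"
        "\<omega> \<notin> U \<union> V"
      have s: "\<bar>(\<Sum>j<n. S j \<omega>) / n - 1\<bar> < \<epsilon> / 2" and t: "(\<Sum>j<n. T j \<omega>) < n * \<theta>"
        using \<omega> unfolding U_def V_def by auto
      have "(\<Sum>j<n. (w j \<omega> / sqrt n)\<^sup>2) = (\<Sum>j<n. S j \<omega>) / n + (\<Sum>j<n. T j \<omega>) / n"
        unfolding T_def by (simp add: power_divide sum_divide_distrib[symmetric] add_divide_distrib[symmetric] sum_subtractf)
      moreover have "0 \<le> (\<Sum>j<n. T j \<omega>) / n"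
        by (intro divide_nonneg_nonneg sum_nonneg T0) simp
      moreover have "(\<Sum>j<n. T j \<omega>) / n \<le> \<epsilon> / 2"
      proof -
        have "(\<Sum>j<n. T j \<omega>) / n \<le> \<theta>" using t n0 by (simp add: pos_divide_le_eq mult.commute)
        thus ?thesis using \<theta>(2) by linarith
      qed
      ultimately have "\<bar>(\<Sum>j<n. (w j \<omega> / sqrt n)\<^sup>2) - 1\<bar> \<le> \<epsilon>" using s by linarith
      moreover have "\<bar>w j \<omega> / sqrt n\<bar> \<le> \<epsilon>" if j: "j < n" for j
      proof -
        have "(w j \<omega>)\<^sup>2 \<le> n * \<epsilon>\<^sup>2"
        proof (cases "(w j \<omega>)\<^sup>2 \<le> 2 * K")
          case True
          have "2 * K / \<epsilon>\<^sup>2 \<le> n" using nC unfolding C_def by simp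
          hence "2 * K \<le> n * \<epsilon>\<^sup>2" using assms by (simp add: field_simps)
          thus ?thesis using True by linarith
        next
          case False
          hence "(w j \<omega>)\<^sup>2 \<le> 2 * T j \<omega>" unfolding T_def S_def using K by (simp add: min_def)
          also have "T j \<omega> \<le> (\<Sum>j<n. T j \<omega>)"
            using j T0 by (intro member_le_sum) auto
          also have "\<dots> \<le> n * (\<epsilon>\<^sup>2 / 2)"
            using t mult_left_mono[OF \<theta>(3), of n] by simp
          finally show ?thesis by simp
        qed
        hence "(w j \<omega> / sqrt n)\<^sup>2 \<le> \<epsilon>\<^sup>2" using n0 by (simp add: power_divide field_simps)
        hence "\<bar>w j \<omega> / sqrt n\<bar> \<le> \<bar>\<epsilon>\<bar>" unfolding abs_le_square_iff .
        thus ?thesis using assms by linarith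
      qed
      ultimately have "nearly_normal_weights \<epsilon> n (\<lambda>j. w j \<omega> / sqrt n)"
        unfolding nearly_normal_weights_def by blast
      thus False using \<omega>(1) by simp
    qed
    hence "M.prob {\<omega> \<in> space M. \<not> nearly_normal_weights \<epsilon> n (\<lambda>j. w j \<omega> / sqrt n)} \<le> M.prob (U \<union> V)"
      using U_meas V_meas by (intro M.finite_measure_mono) auto
    also have "\<dots> \<le> M.prob U + M.prob V"
      using U_meas V_meas by (rule measure_Un_le)
    also have "\<dots> \<le> \<epsilon>" using PU PV by simp
    finally show "M.prob {\<omega> \<in> space M.
        \<not> nearly_normal_weights \<epsilon> n (\<lambda>j. (\<Sum>i<k. a i * B \<omega> $$ (i, j)) / sqrt n)} \<le> \<epsilon>"
      unfolding w_def .
  next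
    show "min \<delta> (\<epsilon> / 8) > 0" using \<delta> assms by simp
  qed
qed

end

section \<open>Conditioning along the chain of factors\<close>

lemma space_borel_mat [simp]: "space (borel_mat m n) = carrier_mat m n"
  unfolding borel_mat_def by simp

lemma measurable_borel_mat_entry:
  assumes "i < m" "j < n"
  shows "(\<lambda>B. B $$ (i, j)) \<in> borel_measurable (borel_mat m n)"
proof -
  let ?f = "\<lambda>B. \<lambda>(i, j) \<in> {..<m} \<times> {..<n}. (B $$ (i, j) :: real)"
  have "?f \<in> borel_mat m n \<rightarrow>\<^sub>M Pi\<^sub>M ({..<m} \<times> {..<n}) (\<lambda>_. borel)"
    unfolding borel_mat_def by (rule measurable_vimage_algebra1) (auto simp: space_PiM)
  hence "(\<lambda>B. ?f B (i, j)) \<in> borel_measurable (borel_mat m n)"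
    by (rule measurable_compose[OF _ measurable_component_singleton]) (use assms in auto)
  thus ?thesis using assms by simp
qed

lemma pred_nearly_normal_weights:
  assumes "\<And>i. i < k \<Longrightarrow> (\<lambda>x. f x i) \<in> borel_measurable N"
  shows "Measurable.pred N (\<lambda>x. nearly_normal_weights \<delta> k (f x))"
proof -
  have [measurable]: "(\<lambda>x. f x i) \<in> borel_measurable N" if "i \<in> {..<k}" for i using assms that by simp
  have "Measurable.pred N (\<lambda>x. \<bar>(\<Sum>i\<in>{..<k}. (f x i)\<^sup>2) - 1\<bar> \<le> \<delta> \<and> (\<forall>i\<in>{..<k}. \<bar>f x i\<bar> \<le> \<delta>))"
    by measurable
  thus ?thesis unfolding nearly_normal_weights_def Ball_def lessThan_iff .
qed

text \<open>Conditioning on \<open>X\<close> by Fubini: the joint law is a product, so a bound on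
  every section of \<open>E\<close> carries over to \<open>E\<close>.\<close>

lemma (in prob_space) prob_indep_pair_le:
  assumes ind: "indep_var S X T Y" and E: "E \<in> sets (S \<Otimes>\<^sub>M T)" and "e \<ge> 0"
    and le: "\<And>x. x \<in> space S \<Longrightarrow> prob {\<omega> \<in> space M. (x, Y \<omega>) \<in> E} \<le> e"
  shows "prob {\<omega> \<in> space M. (X \<omega>, Y \<omega>) \<in> E} \<le> e"
proof -
  have X[measurable]: "random_variable S X" and Y[measurable]: "random_variable T Y"
    and eq: "distr M S X \<Otimes>\<^sub>M distr M T Y = distr M (S \<Otimes>\<^sub>M T) (\<lambda>x. (X x, Y x))"
    using ind unfolding indep_var_distribution_eq by auto
  interpret X: prob_space "distr M S X" by (rule prob_space_distr) measurable
  interpret Y: prob_space "distr M T Y" by (rule prob_space_distr) measurable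
  have sets: "sets (distr M S X \<Otimes>\<^sub>M distr M T Y) = sets (S \<Otimes>\<^sub>M T)"
    by (rule sets_pair_measure_cong) simp_all
  have "emeasure M {\<omega> \<in> space M. (X \<omega>, Y \<omega>) \<in> E} = emeasure (distr M S X \<Otimes>\<^sub>M distr M T Y) E"
    unfolding eq using E by (subst emeasure_distr) (auto intro!: arg_cong[where f = "emeasure M"])
  also have "\<dots> = (\<integral>\<^sup>+x. emeasure (distr M T Y) (Pair x -` E) \<partial>distr M S X)"
    by (rule Y.emeasure_pair_measure_alt) (use E sets in simp)
  also have "\<dots> \<le> (\<integral>\<^sup>+x. ennreal e \<partial>distr M S X)"
  proof (rule nn_integral_mono)
    fix x assume "x \<in> space (distr M S X)"
    hence x: "x \<in> space S" by simp
    have "emeasure (distr M T Y) (Pair x -` E) = emeasure M {\<omega> \<in> space M. (x, Y \<omega>) \<in> E}"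
      using E by (subst emeasure_distr) (auto intro!: arg_cong[where f = "emeasure M"] sets_Pair1)
    also have "\<dots> \<le> ennreal e"
      using le[OF x] by (simp add: emeasure_eq_measure ennreal_leI)
    finally show "emeasure (distr M T Y) (Pair x -` E) \<le> ennreal e" .
  qed
  also have "\<dots> = ennreal e" by (simp only: nn_integral_const X.emeasure_space_1 mult_1_right)
  finally show ?thesis using \<open>e \<ge> 0\<close> by (simp add: emeasure_eq_measure)
qed

text \<open>\<open>normalized_row d F q\<close> is the row vector \<open>1 F\<^sub>1 \<dots> F\<^sub>q\<close>, divided by \<open>sqrt (d 0 * \<dots> * d q)\<close>.\<close>

primrec normalized_row :: "(nat \<Rightarrow> nat) \<Rightarrow> (nat \<Rightarrow> real mat) \<Rightarrow> nat \<Rightarrow> nat \<Rightarrow> real" where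
  "normalized_row d F 0 = (\<lambda>i\<in>{..<d 0}. 1 / sqrt (d 0))"
| "normalized_row d F (Suc q) = (\<lambda>j\<in>{..<d (Suc q)}.
     (\<Sum>i<d q. normalized_row d F q i * F (Suc q) $$ (i, j)) / sqrt (d (Suc q)))"

text \<open>Locality in the factors: it allows the family of factors to be restricted to
  \<open>{1..q}\<close> without changing the row.\<close>

lemma normalized_row_cong:
  "(\<And>r. r \<in> {1..q} \<Longrightarrow> F r = G r) \<Longrightarrow> normalized_row d F q = normalized_row d G q"
  by (induction q) auto

text \<open>The index set is left general for two uses: \<open>{1..p}\<close> gives measurability on
  the sample space, and \<open>{1..q}\<close> exhibits the row as a function of the earlier factors
  alone. The restrictions in \<open>normalized_row\<close> make its values points of a product
  space.\<close>

lemma measurable_normalized_row: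
  assumes "{1..q} \<subseteq> I"
  shows "(\<lambda>F. normalized_row d F q) \<in>
    Pi\<^sub>M I (\<lambda>r. borel_mat (d (r - 1)) (d r)) \<rightarrow>\<^sub>M Pi\<^sub>M {..<d q} (\<lambda>_. borel)"
  using assms
proof (induction q)
  case 0
  have "restrict (\<lambda>i. 1 / sqrt (d 0)) {..<d 0} \<in> space (Pi\<^sub>M {..<d 0} (\<lambda>_. borel :: real measure))"
    by (auto simp: space_PiM)
  hence "(\<lambda>_. restrict (\<lambda>i. 1 / sqrt (d 0)) {..<d 0}) \<in>
    Pi\<^sub>M I (\<lambda>r. borel_mat (d (r - 1)) (d r)) \<rightarrow>\<^sub>M Pi\<^sub>M {..<d 0} (\<lambda>_. borel :: real measure)"
    by (rule measurable_const)
  thus ?case by (simp only: normalized_row.simps)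
next
  case (Suc q)
  have row: "(\<lambda>F. normalized_row d F q) \<in>
    Pi\<^sub>M I (\<lambda>r. borel_mat (d (r - 1)) (d r)) \<rightarrow>\<^sub>M Pi\<^sub>M {..<d q} (\<lambda>_. borel)"
    using Suc.prems by (intro Suc.IH) auto
  have mat: "(\<lambda>F. F (Suc q)) \<in>
    Pi\<^sub>M I (\<lambda>r. borel_mat (d (r - 1)) (d r)) \<rightarrow>\<^sub>M borel_mat (d q) (d (Suc q))"
  proof -
    have "Suc q \<in> I" using Suc.prems by auto
    from measurable_component_singleton[OF this, of "\<lambda>r. borel_mat (d (r - 1)) (d r)"] show ?thesis
      by (simp only: diff_Suc_1)
  qed
  show ?case unfolding normalized_row.simps
    by (intro measurable_restrict borel_measurable_divide borel_measurable_const
        borel_measurable_sum borel_measurable_times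
        measurable_compose[OF row measurable_component_singleton]
        measurable_compose[OF mat measurable_borel_mat_entry]) auto
qed

text \<open>The random factors for one choice of dimensions; the asymptotic lemmas below quantify
  over all instances of this locale.\<close>

locale iid_matrix_chain = prob_space M for M :: "'w measure" +
  fixes d :: "nat \<Rightarrow> nat" and p :: nat and A :: "nat \<Rightarrow> 'w \<Rightarrow> real mat" and \<mu> :: "nat \<Rightarrow> real measure"
  assumes indep: "indep_vars (\<lambda>q. borel_mat (d (q - 1)) (d q)) A {1..p}"
    and iid: "q \<in> {1..p} \<Longrightarrow> iid_entries M (A q) (d (q - 1)) (d q) (\<mu> q)"
begin

abbreviation row :: "nat \<Rightarrow> 'w \<Rightarrow> nat \<Rightarrow> real" where
  "row q \<omega> \<equiv> normalized_row d (\<lambda>r. A r \<omega>) q"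

lemma row_measurable: "q \<le> p \<Longrightarrow> j < d q \<Longrightarrow> (\<lambda>\<omega>. row q \<omega> j) \<in> borel_measurable M"
proof -
  assume q: "q \<le> p" and j: "j < d q"
  have "(\<lambda>\<omega>. \<lambda>r\<in>{1..p}. A r \<omega>) \<in> M \<rightarrow>\<^sub>M Pi\<^sub>M {1..p} (\<lambda>r. borel_mat (d (r - 1)) (d r))"
    using indep by (intro measurable_restrict) (auto simp: indep_vars_def)
  hence "(\<lambda>\<omega>. normalized_row d (\<lambda>r\<in>{1..p}. A r \<omega>) q) \<in> M \<rightarrow>\<^sub>M Pi\<^sub>M {..<d q} (\<lambda>_. borel)"
    by (rule measurable_compose[OF _ measurable_normalized_row]) (use q in simp)
  moreover have "normalized_row d (\<lambda>r\<in>{1..p}. A r \<omega>) q = row q \<omega>" for \<omega>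
    using q by (intro normalized_row_cong) auto
  ultimately have "row q \<in> M \<rightarrow>\<^sub>M Pi\<^sub>M {..<d q} (\<lambda>_. borel)" by simp
  thus ?thesis by (rule measurable_compose[OF _ measurable_component_singleton]) (use j in simp)
qed

lemma pred_row: "q \<le> p \<Longrightarrow> Measurable.pred M (\<lambda>\<omega>. nearly_normal_weights \<delta> (d q) (row q \<omega>))"
  by (intro pred_nearly_normal_weights row_measurable)

text \<open>The row after \<open>q\<close> factors is independent of factor \<open>Suc q\<close>, so
  a bound valid for every deterministic good \<open>a\<close> carries over to the random row.
  \<open>Q\<close> is evaluated on the product of the spaces of earlier factors and of the next one,
  which fixes the type in its measurability hypothesis.\<close>

lemma prob_next_factor_le:
  assumes "q < p" "\<epsilon> \<ge> 0"
    and Q: "\<And>(N :: ((nat \<Rightarrow> real mat) \<times> (nat \<Rightarrow> real mat)) measure) g.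
      (\<And>j. j < d (Suc q) \<Longrightarrow> (\<lambda>x. g x j) \<in> borel_measurable N) \<Longrightarrow> Measurable.pred N (\<lambda>x. Q (g x))"
    and le: "\<And>a. nearly_normal_weights \<delta> (d q) a \<Longrightarrow>
      prob {\<omega> \<in> space M. Q (\<lambda>j. \<Sum>i<d q. a i * A (Suc q) \<omega> $$ (i, j))} \<le> \<epsilon>"
  shows "prob {\<omega> \<in> space M. nearly_normal_weights \<delta> (d q) (row q \<omega>) \<and>
      Q (\<lambda>j. \<Sum>i<d q. row q \<omega> i * A (Suc q) \<omega> $$ (i, j))} \<le> \<epsilon>"
proof -
  let ?N = "\<lambda>q. borel_mat (d (q - 1)) (d q)"
  \<comment> \<open>The next factor is also encoded as a restricted family, over a singleton, since
    independence of disjoint blocks has this form.\<close>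
  let ?S = "Pi\<^sub>M {1..q} ?N" and ?T = "Pi\<^sub>M {Suc q} ?N"
  let ?X = "\<lambda>\<omega>. restrict (\<lambda>r. A r \<omega>) {1..q}" and ?Y = "\<lambda>\<omega>. restrict (\<lambda>r. A r \<omega>) {Suc q}"
  let ?row = "\<lambda>F. normalized_row d F q"
  let ?P = "\<lambda>x. nearly_normal_weights \<delta> (d q) (?row (fst x)) \<and>
      Q (\<lambda>j. \<Sum>i<d q. ?row (fst x) i * snd x (Suc q) $$ (i, j))"
  define E where "E = {x \<in> space (?S \<Otimes>\<^sub>M ?T). ?P x}"
  have ind: "indep_var ?S ?X ?T ?Y"
    using assms(1) by (intro indep_var_restrict[OF indep]) auto
  have X: "?X \<omega> \<in> space ?S" and Y: "?Y \<omega> \<in> space ?T" if "\<omega> \<in> space M" for \<omega>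
    using measurable_space[OF indep_var_rv1[OF ind] that] measurable_space[OF indep_var_rv2[OF ind] that] .
  have rowX: "?row (?X \<omega>) = row q \<omega>" for \<omega>
    by (intro normalized_row_cong) auto
  have row: "?row \<in> ?S \<rightarrow>\<^sub>M Pi\<^sub>M {..<d q} (\<lambda>_. borel)"
    by (rule measurable_normalized_row) simp
  have fst: "(\<lambda>x. ?row (fst x) i) \<in> borel_measurable (?S \<Otimes>\<^sub>M ?T)" if "i < d q" for i
    by (rule measurable_compose[OF measurable_compose[OF measurable_fst row] measurable_component_singleton])
       (use that in simp)
  have factor: "(\<lambda>F. F (Suc q)) \<in> ?T \<rightarrow>\<^sub>M ?N (Suc q)"
    by (rule measurable_component_singleton) simp
  have snd: "(\<lambda>x. snd x (Suc q) $$ (i, j)) \<in> borel_measurable (?S \<Otimes>\<^sub>M ?T)"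
    if "i < d q" "j < d (Suc q)" for i j
    by (rule measurable_compose[OF measurable_compose[OF measurable_snd factor] measurable_borel_mat_entry])
       (use that in simp_all)
  have "Measurable.pred (?S \<Otimes>\<^sub>M ?T) (\<lambda>x. nearly_normal_weights \<delta> (d q) (?row (fst x)))"
    by (rule pred_nearly_normal_weights) (rule fst)
  moreover have "Measurable.pred (?S \<Otimes>\<^sub>M ?T) (\<lambda>x. Q (\<lambda>j. \<Sum>i<d q. ?row (fst x) i * snd x (Suc q) $$ (i, j)))"
    by (rule Q) (intro borel_measurable_sum borel_measurable_times fst snd, simp_all)
  ultimately have "Measurable.pred (?S \<Otimes>\<^sub>M ?T) ?P" by (rule pred_intros_logic)
  hence E: "E \<in> sets (?S \<Otimes>\<^sub>M ?T)" unfolding E_def pred_def .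
  have "prob {\<omega> \<in> space M. (?X \<omega>, ?Y \<omega>) \<in> E} \<le> \<epsilon>"
  proof (rule prob_indep_pair_le[OF ind E \<open>\<epsilon> \<ge> 0\<close>])
    fix F assume F: "F \<in> space ?S"
    show "prob {\<omega> \<in> space M. (F, ?Y \<omega>) \<in> E} \<le> \<epsilon>"
    proof (cases "nearly_normal_weights \<delta> (d q) (?row F)")
      case True
      have "{\<omega> \<in> space M. (F, ?Y \<omega>) \<in> E} =
          {\<omega> \<in> space M. Q (\<lambda>j. \<Sum>i<d q. ?row F i * A (Suc q) \<omega> $$ (i, j))}"
        unfolding E_def space_pair_measure using F Y True by (simp cong: conj_cong)
      thus ?thesis using le[OF True] by simp
    next
      case False
      hence "{\<omega> \<in> space M. (F, ?Y \<omega>) \<in> E} = {}" unfolding E_def by auto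
      thus ?thesis using \<open>\<epsilon> \<ge> 0\<close> by (simp only: measure_empty)
    qed
  qed
  also have "{\<omega> \<in> space M. (?X \<omega>, ?Y \<omega>) \<in> E} =
      {\<omega> \<in> space M. nearly_normal_weights \<delta> (d q) (row q \<omega>) \<and>
      Q (\<lambda>j. \<Sum>i<d q. row q \<omega> i * A (Suc q) \<omega> $$ (i, j))}"
    unfolding E_def space_pair_measure using X Y by (simp add: rowX[unfolded One_nat_def] cong: conj_cong)
  finally show ?thesis .
qed

lemma factor_measurable: "q < p \<Longrightarrow> A (Suc q) \<in> M \<rightarrow>\<^sub>M borel_mat (d q) (d (Suc q))"
proof -
  assume "q < p"
  moreover have "A r \<in> M \<rightarrow>\<^sub>M borel_mat (d (r - 1)) (d r)" if "r \<in> {1..p}" for r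
    using indep that unfolding indep_vars_def by blast
  from this[of "Suc q"] show ?thesis using \<open>q < p\<close> by simp
qed

lemma entry_measurable:
  "q < p \<Longrightarrow> i < d q \<Longrightarrow> j < d (Suc q) \<Longrightarrow> (\<lambda>\<omega>. A (Suc q) \<omega> $$ (i, j)) \<in> borel_measurable M"
  by (rule measurable_compose[OF factor_measurable measurable_borel_mat_entry])

lemma iid_Suc: "q < p \<Longrightarrow> iid_entries M (A (Suc q)) (d q) (d (Suc q)) (\<mu> (Suc q))"
  using iid[of "Suc q"] by simp

lemma carrier_Suc: "q < p \<Longrightarrow> \<omega> \<in> space M \<Longrightarrow> A (Suc q) \<omega> \<in> carrier_mat (d q) (d (Suc q))"
  using measurable_space[OF factor_measurable] by simp

end

text \<open>Tolerances are chosen backwards: the target \<open>\<epsilon> / 2\<close> for the next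
  factor dictates the tolerance demanded of the current row, at which the induction hypothesis is
  then used. Hence \<open>\<epsilon>\<close> is arbitrary in the induction, and \<open>N\<close> is
  chosen before the space and the dimensions.\<close>

lemma normalized_row_nearly_normal:
  fixes \<mu> :: "nat \<Rightarrow> real measure"
  assumes std: "\<And>q. q \<in> {1..p} \<Longrightarrow> standardized_law (\<mu> q)" and "q \<le> p" "\<epsilon> > 0"
  shows "\<exists>N. \<forall>(M :: 'w measure) d A. iid_matrix_chain M d p A \<mu> \<longrightarrow> (\<forall>r\<le>p. N \<le> d r) \<longrightarrow>
    measure M {\<omega> \<in> space M.
      \<not> nearly_normal_weights \<epsilon> (d q) (normalized_row d (\<lambda>r. A r \<omega>) q)} \<le> \<epsilon>"
  using assms(2,3)
proof (induction q arbitrary: \<epsilon>)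
  case 0
  \<comment> \<open>The initial constant row has square sum exactly 1, so only its entries
    \<open>1 / sqrt (d 0)\<close> have to be made small.\<close>
  define N where "N = Suc (nat \<lceil>1 / \<epsilon>\<^sup>2\<rceil>)"
  have "nearly_normal_weights \<epsilon> (d 0) (normalized_row d F 0)"
    if "N \<le> d 0" for d :: "nat \<Rightarrow> nat" and F
  proof -
    have d: "d 0 > 0" "1 / \<epsilon>\<^sup>2 \<le> d 0" using that unfolding N_def by (simp, linarith)
    hence "1 \<le> \<epsilon>\<^sup>2 * d 0" using 0 by (simp add: field_simps)
    hence "1 \<le> sqrt (\<epsilon>\<^sup>2 * d 0)" by simp
    also have "\<dots> = \<epsilon> * sqrt (d 0)" using 0 by (simp add: real_sqrt_mult)
    finally have "1 / sqrt (d 0) \<le> \<epsilon>" using d(1) by (simp add: field_simps)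
    thus ?thesis using d 0 by (simp add: nearly_normal_weights_def power_divide)
  qed
  hence empty: "{\<omega> \<in> space M. \<not> nearly_normal_weights \<epsilon> (d 0) (normalized_row d (\<lambda>r. A r \<omega>) 0)} = {}"
    if "N \<le> d 0" for M :: "'w measure" and d A
    using that by blast
  show ?case
  proof (intro exI[of _ N] allI impI)
    fix M :: "'w measure" and d A assume "\<forall>r\<le>p. N \<le> d r"
    thus "measure M {\<omega> \<in> space M.
      \<not> nearly_normal_weights \<epsilon> (d 0) (normalized_row d (\<lambda>r. A r \<omega>) 0)} \<le> \<epsilon>"
      using 0 by (subst empty) auto
  qed
next
  case (Suc q)
  interpret L: standardized_law "\<mu> (Suc q)" using std[of "Suc q"] Suc.prems(1) by simp
  have "\<epsilon> / 2 > 0" using Suc.prems by simp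
  from L.layer_nearly_normal[OF this] obtain \<delta> N1 where \<delta>: "\<delta> > 0" and layer:
    "\<And>(M :: 'w measure) B k n a. prob_space M \<Longrightarrow> iid_entries M B k n (\<mu> (Suc q)) \<Longrightarrow>
      nearly_normal_weights \<delta> k a \<Longrightarrow> N1 \<le> n \<Longrightarrow>
      measure M {\<omega> \<in> space M.
        \<not> nearly_normal_weights (\<epsilon> / 2) n (\<lambda>j. (\<Sum>i<k. a i * B \<omega> $$ (i, j)) / sqrt n)} \<le> \<epsilon> / 2"
    by blast
  \<comment> \<open>The induction hypothesis uses one parameter as tolerance and as probability: the
    first role needs at most \<open>\<delta>\<close>, the second at most
    \<open>\<epsilon> / 2\<close>.\<close>
  define \<delta>' where "\<delta>' = min \<delta> (\<epsilon> / 2)"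
  have "\<delta>' > 0" "q \<le> p" using \<delta> Suc.prems unfolding \<delta>'_def by auto
  then obtain N2 where N2: "\<And>(M :: 'w measure) d A. iid_matrix_chain M d p A \<mu> \<Longrightarrow> (\<forall>r\<le>p. N2 \<le> d r) \<Longrightarrow>
    measure M {\<omega> \<in> space M.
      \<not> nearly_normal_weights \<delta>' (d q) (normalized_row d (\<lambda>r. A r \<omega>) q)} \<le> \<delta>'"
    using Suc.IH by blast
  show ?case
  proof (intro exI[of _ "max N1 N2"] allI impI)
    fix M :: "'w measure" and d A
    assume chain: "iid_matrix_chain M d p A \<mu>" and d: "\<forall>r\<le>p. max N1 N2 \<le> d r"
    interpret iid_matrix_chain M d p A \<mu> by fact
    have q: "q < p" using Suc.prems by simp
    let ?Q = "\<lambda>w. \<not> nearly_normal_weights (\<epsilon> / 2) (d (Suc q)) (\<lambda>j. w j / sqrt (d (Suc q)))"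
    let ?w = "\<lambda>\<omega> j. \<Sum>i<d q. row q \<omega> i * A (Suc q) \<omega> $$ (i, j)"
    \<comment> \<open>A bad new row means either that the old row was already bad or that the new
      factor spoiled a good one; each event costs \<open>\<epsilon> / 2\<close>.\<close>
    let ?bad = "{\<omega> \<in> space M. \<not> nearly_normal_weights \<delta>' (d q) (row q \<omega>)}"
    let ?step = "{\<omega> \<in> space M. nearly_normal_weights \<delta>' (d q) (row q \<omega>) \<and> ?Q (?w \<omega>)}"
    have Q_pred: "Measurable.pred N (\<lambda>x. ?Q (g x))"
      if "\<And>j. j < d (Suc q) \<Longrightarrow> (\<lambda>x. g x j) \<in> borel_measurable N"
      for N :: "'z measure" and g :: "'z \<Rightarrow> nat \<Rightarrow> real"
      by (intro pred_intros_logic pred_nearly_normal_weights borel_measurable_divide that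
          borel_measurable_const)
    have "prob ?step \<le> \<epsilon> / 2"
    proof (rule prob_next_factor_le[OF q])
      fix a assume a: "nearly_normal_weights \<delta>' (d q) a"
      have "nearly_normal_weights \<delta> (d q) a"
        using a by (rule nearly_normal_weights_mono) (simp add: \<delta>'_def)
      thus "prob {\<omega> \<in> space M. ?Q (\<lambda>j. \<Sum>i<d q. a i * A (Suc q) \<omega> $$ (i, j))} \<le> \<epsilon> / 2"
        using d Suc.prems(1) by (intro layer prob_space_axioms iid_Suc q) auto
    qed (use Suc.prems Q_pred in auto)
    moreover have "prob ?bad \<le> \<epsilon> / 2"
      using N2[OF chain] d unfolding \<delta>'_def by force
    moreover have bad_meas: "?bad \<in> events"
      using pred_row[OF less_imp_le[OF q], of \<delta>'] by measurable
    moreover have step_meas: "?step \<in> events"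
    proof -
      have "Measurable.pred M (\<lambda>\<omega>. ?Q (?w \<omega>))"
        using q by (intro Q_pred borel_measurable_sum borel_measurable_times row_measurable
          entry_measurable) auto
      thus ?thesis using pred_row[OF less_imp_le[OF q], of \<delta>'] by measurable
    qed
    moreover have "{\<omega> \<in> space M. \<not> nearly_normal_weights \<epsilon> (d (Suc q)) (row (Suc q) \<omega>)} \<subseteq> ?bad \<union> ?step"
    proof
      fix \<omega> assume \<omega>: "\<omega> \<in> {\<omega> \<in> space M. \<not> nearly_normal_weights \<epsilon> (d (Suc q)) (row (Suc q) \<omega>)}"
      have "?Q (?w \<omega>)"
      proof
        assume "nearly_normal_weights (\<epsilon> / 2) (d (Suc q)) (\<lambda>j. ?w \<omega> j / sqrt (d (Suc q)))"
        hence "nearly_normal_weights \<epsilon> (d (Suc q)) (\<lambda>j. ?w \<omega> j / sqrt (d (Suc q)))"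
          by (rule nearly_normal_weights_mono) (use Suc.prems in simp)
        hence "nearly_normal_weights \<epsilon> (d (Suc q)) (row (Suc q) \<omega>)"
          unfolding nearly_normal_weights_def by simp
        thus False using \<omega> by simp
      qed
      thus "\<omega> \<in> ?bad \<union> ?step" using \<omega> by blast
    qed
    ultimately show "prob {\<omega> \<in> space M. \<not> nearly_normal_weights \<epsilon> (d (Suc q)) (row (Suc q) \<omega>)} \<le> \<epsilon>"
      using finite_measure_mono[of _ "?bad \<union> ?step"] measure_Un_le[OF bad_meas step_meas]
      by (smt (verit) field_sum_of_halves sets.Un)
  qed
qed

text \<open>The same conditioning as in the induction step above, with the averages of absolute
  values as the event for the last factor, which is not divided by the square root of its
  width.\<close>

lemma abs_mean_last_factor:
  fixes \<mu> :: "nat \<Rightarrow> real measure"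
  assumes std: "\<And>r. r \<in> {1..Suc q} \<Longrightarrow> standardized_law (\<mu> r)" and "\<epsilon> > 0"
  shows "\<exists>N. \<forall>(M :: 'w measure) d A. iid_matrix_chain M d (Suc q) A \<mu> \<longrightarrow> (\<forall>r\<le>Suc q. N \<le> d r) \<longrightarrow>
    measure M {\<omega> \<in> space M.
      \<bar>(\<Sum>j<d (Suc q). \<bar>\<Sum>i<d q. normalized_row d (\<lambda>r. A r \<omega>) q i * A (Suc q) \<omega> $$ (i, j)\<bar>) / d (Suc q)
        - sqrt (2 / pi)\<bar> \<ge> \<epsilon>} \<le> \<epsilon>"
proof -
  interpret L: standardized_law "\<mu> (Suc q)" using std[of "Suc q"] by simp
  have "\<epsilon> / 2 > 0" using assms by simp
  from L.layer_abs_mean[OF this] obtain \<delta> N1 where \<delta>: "\<delta> > 0" and layer: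
    "\<And>(M :: 'w measure) B k n a. prob_space M \<Longrightarrow> iid_entries M B k n (\<mu> (Suc q)) \<Longrightarrow>
      nearly_normal_weights \<delta> k a \<Longrightarrow> N1 \<le> n \<Longrightarrow>
      measure M {\<omega> \<in> space M. \<bar>(\<Sum>j<n. \<bar>\<Sum>i<k. a i * B \<omega> $$ (i, j)\<bar>) / n - sqrt (2 / pi)\<bar> \<ge> \<epsilon> / 2} \<le> \<epsilon> / 2"
    by blast
  define \<delta>' where "\<delta>' = min \<delta> (\<epsilon> / 2)"
  have "\<delta>' > 0" using \<delta> assms unfolding \<delta>'_def by auto
  then obtain N2 where N2: "\<And>(M :: 'w measure) d A. iid_matrix_chain M d (Suc q) A \<mu> \<Longrightarrow> (\<forall>r\<le>Suc q. N2 \<le> d r) \<Longrightarrow>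
    measure M {\<omega> \<in> space M.
      \<not> nearly_normal_weights \<delta>' (d q) (normalized_row d (\<lambda>r. A r \<omega>) q)} \<le> \<delta>'"
    using normalized_row_nearly_normal[of "Suc q" \<mu> q \<delta>', OF std] by auto
  show ?thesis
  proof (intro exI[of _ "max N1 N2"] allI impI)
    fix M :: "'w measure" and d A
    assume chain: "iid_matrix_chain M d (Suc q) A \<mu>" and d: "\<forall>r\<le>Suc q. max N1 N2 \<le> d r"
    interpret iid_matrix_chain M d "Suc q" A \<mu> by fact
    let ?Q = "\<lambda>w. \<bar>(\<Sum>j<d (Suc q). \<bar>w j\<bar>) / d (Suc q) - sqrt (2 / pi)\<bar> \<ge> \<epsilon> / 2"
    let ?w = "\<lambda>\<omega> j. \<Sum>i<d q. row q \<omega> i * A (Suc q) \<omega> $$ (i, j)"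
    let ?bad = "{\<omega> \<in> space M. \<not> nearly_normal_weights \<delta>' (d q) (row q \<omega>)}"
    let ?step = "{\<omega> \<in> space M. nearly_normal_weights \<delta>' (d q) (row q \<omega>) \<and> ?Q (?w \<omega>)}"
    have Q_pred: "Measurable.pred N (\<lambda>x. ?Q (g x))"
      if "\<And>j. j < d (Suc q) \<Longrightarrow> (\<lambda>x. g x j) \<in> borel_measurable N"
      for N :: "'z measure" and g :: "'z \<Rightarrow> nat \<Rightarrow> real"
    proof -
      have [measurable]: "(\<lambda>x. \<Sum>j<d (Suc q). \<bar>g x j\<bar>) \<in> borel_measurable N"
        by (intro borel_measurable_sum borel_measurable_abs that) simp
      show ?thesis by measurable
    qed
    have "prob ?step \<le> \<epsilon> / 2"
    proof (rule prob_next_factor_le[OF lessI])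
      fix a assume a: "nearly_normal_weights \<delta>' (d q) a"
      have "nearly_normal_weights \<delta> (d q) a"
        using a by (rule nearly_normal_weights_mono) (simp add: \<delta>'_def)
      thus "prob {\<omega> \<in> space M. ?Q (\<lambda>j. \<Sum>i<d q. a i * A (Suc q) \<omega> $$ (i, j))} \<le> \<epsilon> / 2"
        using d by (intro layer prob_space_axioms iid_Suc) auto
    qed (use assms Q_pred in auto)
    moreover have "prob ?bad \<le> \<epsilon> / 2"
      using N2[OF chain] d unfolding \<delta>'_def by force
    moreover have bad_meas: "?bad \<in> events"
      using pred_row[of q \<delta>'] by measurable
    moreover have step_meas: "?step \<in> events"
    proof -
      have "Measurable.pred M (\<lambda>\<omega>. ?Q (?w \<omega>))"
        by (intro Q_pred borel_measurable_sum borel_measurable_times row_measurable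
          entry_measurable) auto
      thus ?thesis using pred_row[of q \<delta>'] by measurable
    qed
    moreover have "{\<omega> \<in> space M. \<bar>(\<Sum>j<d (Suc q). \<bar>?w \<omega> j\<bar>) / d (Suc q) - sqrt (2 / pi)\<bar> \<ge> \<epsilon>} \<subseteq> ?bad \<union> ?step"
      using assms by auto
    ultimately show "prob {\<omega> \<in> space M. \<bar>(\<Sum>j<d (Suc q). \<bar>?w \<omega> j\<bar>) / d (Suc q) - sqrt (2 / pi)\<bar> \<ge> \<epsilon>} \<le> \<epsilon>"
      using finite_measure_mono[of _ "?bad \<union> ?step"] measure_Un_le[OF bad_meas step_meas]
      by (smt (verit) field_sum_of_halves sets.Un)
  qed
qed

section \<open>The operator norm of the product\<close>

lemma linf_norm_le_iff:
  assumes "0 < dim_vec x"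
  shows "linf_norm x \<le> c \<longleftrightarrow> (\<forall>j<dim_vec x. \<bar>x $ j\<bar> \<le> c)"
  unfolding linf_norm_def using assms by (subst Max_le_iff) auto

text \<open>With equal rows all entries of the image vector coincide, so the supremum is that of one
  linear form on the unit cube, attained at the vector of signs.\<close>

lemma linf_op_norm_equal_rows:
  assumes A: "A \<in> carrier_mat m n" and "m > 0" "n > 0"
    and r: "\<And>i j. i < m \<Longrightarrow> j < n \<Longrightarrow> A $$ (i, j) = r j"
  shows "linf_op_norm A = (\<Sum>j<n. \<bar>r j\<bar>)"
proof -
  have val: "linf_norm (A *\<^sub>v x) = \<bar>\<Sum>j<n. r j * x $ j\<bar>" if x: "x \<in> carrier_vec n" for x
  proof -
    have "(A *\<^sub>v x) $ i = (\<Sum>j<n. r j * x $ j)" if "i < m" for i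
      using A x that r by (simp add: scalar_prod_def lessThan_atLeast0)
    hence "(\<lambda>i. \<bar>(A *\<^sub>v x) $ i\<bar>) ` {..<dim_vec (A *\<^sub>v x)} = {\<bar>\<Sum>j<n. r j * x $ j\<bar>}"
      using A \<open>m > 0\<close> by (auto simp: image_def)
    thus ?thesis unfolding linf_norm_def by simp
  qed
  define s where "s = vec n (\<lambda>j. sgn (r j))"
  have s: "s \<in> carrier_vec n" "linf_norm s \<le> 1"
    using \<open>n > 0\<close> by (auto simp: s_def linf_norm_le_iff sgn_real_def)
  have vs: "linf_norm (A *\<^sub>v s) = (\<Sum>j<n. \<bar>r j\<bar>)"
    unfolding val[OF s(1)] by (simp add: s_def abs_sgn[symmetric] sum_nonneg)
  show ?thesis unfolding linf_op_norm_def
  proof (rule cSup_eq_maximum)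
    show "(\<Sum>j<n. \<bar>r j\<bar>) \<in> (\<lambda>x. linf_norm (A *\<^sub>v x)) ` {x \<in> carrier_vec (dim_col A). linf_norm x \<le> 1}"
      using s vs A by (intro image_eqI[of _ _ s]) auto
    fix y assume "y \<in> (\<lambda>x. linf_norm (A *\<^sub>v x)) ` {x \<in> carrier_vec (dim_col A). linf_norm x \<le> 1}"
    then obtain x where x: "x \<in> carrier_vec n" "linf_norm x \<le> 1" and y: "y = linf_norm (A *\<^sub>v x)"
      using A by auto
    have "\<bar>\<Sum>j<n. r j * x $ j\<bar> \<le> (\<Sum>j<n. \<bar>r j\<bar> * 1)"
      using x \<open>n > 0\<close>
      by (intro order_trans[OF sum_abs sum_mono]) (auto simp: abs_mult linf_norm_le_iff intro!: mult_left_le)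
    thus "y \<le> (\<Sum>j<n. \<bar>r j\<bar>)" unfolding y val[OF x(1)] by simp
  qed
qed

text \<open>The recursion starts at 1 because \<open>mat_chain_prod F 0\<close> is
  \<open>F 1\<close> as well.\<close>

lemma mat_chain_prod_Suc:
  "q \<ge> 1 \<Longrightarrow> mat_chain_prod F (Suc q) = mat_chain_prod F q * F (Suc q)"
  by (simp add: mat_chain_prod_def)

text \<open>The column sums are the entries of the all-ones row times the product. Each step brings
  one more dimension under the root, cancelling the division in \<open>normalized_row\<close>; the
  last factor stays unnormalized.\<close>

lemma column_sums_mat_chain_prod:
  assumes F: "\<And>r. r \<le> q \<Longrightarrow> F (Suc r) \<in> carrier_mat (d r) (d (Suc r))" and d: "\<And>r. r \<le> q \<Longrightarrow> d r > 0"
  shows "mat_chain_prod F (Suc q) \<in> carrier_mat (d 0) (d (Suc q)) \<and>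
    (\<forall>j<d (Suc q). (\<Sum>i<d 0. mat_chain_prod F (Suc q) $$ (i, j)) =
      sqrt (\<Prod>r<Suc q. real (d r)) * (\<Sum>i<d q. normalized_row d F q i * F (Suc q) $$ (i, j)))"
  using assms
proof (induction q)
  case 0
  thus ?case by (simp add: mat_chain_prod_def sum_distrib_left)
next
  case (Suc q)
  let ?P = "mat_chain_prod F (Suc q)" and ?G = "F (Suc (Suc q))"
  have IH: "?P \<in> carrier_mat (d 0) (d (Suc q))"
    "\<And>j. j < d (Suc q) \<Longrightarrow> (\<Sum>i<d 0. ?P $$ (i, j)) =
      sqrt (\<Prod>r<Suc q. real (d r)) * (\<Sum>i<d q. normalized_row d F q i * F (Suc q) $$ (i, j))"
    using Suc by auto
  have G: "?G \<in> carrier_mat (d (Suc q)) (d (Suc (Suc q)))" using Suc.prems by auto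
  have dpos: "d (Suc q) > 0" using Suc.prems by auto
  have "(\<Sum>i<d 0. (?P * ?G) $$ (i, j)) =
      sqrt (\<Prod>r<Suc (Suc q). real (d r)) * (\<Sum>l<d (Suc q). normalized_row d F (Suc q) l * ?G $$ (l, j))"
    if j: "j < d (Suc (Suc q))" for j
  proof -
    have "(\<Sum>i<d 0. (?P * ?G) $$ (i, j)) = (\<Sum>i<d 0. \<Sum>l<d (Suc q). ?P $$ (i, l) * ?G $$ (l, j))"
      using IH(1) G j by (intro sum.cong) (auto simp: scalar_prod_def lessThan_atLeast0)
    also have "\<dots> = (\<Sum>l<d (Suc q). (\<Sum>i<d 0. ?P $$ (i, l)) * ?G $$ (l, j))"
      by (subst sum.swap) (simp add: sum_distrib_right)
    also have "\<dots> = (\<Sum>l<d (Suc q). sqrt (\<Prod>r<Suc (Suc q). real (d r)) *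
        (normalized_row d F (Suc q) l * ?G $$ (l, j)))"
    proof (rule sum.cong)
      fix l assume l: "l \<in> {..<d (Suc q)}"
      have "sqrt (\<Prod>r<Suc (Suc q). real (d r)) = sqrt (\<Prod>r<Suc q. real (d r)) * sqrt (d (Suc q))"
        by (simp add: real_sqrt_mult)
      thus "(\<Sum>i<d 0. ?P $$ (i, l)) * ?G $$ (l, j) =
          sqrt (\<Prod>r<Suc (Suc q). real (d r)) * (normalized_row d F (Suc q) l * ?G $$ (l, j))"
        using l dpos IH(2)[of l] by simp
    qed simp
    finally show ?thesis by (simp add: sum_distrib_left)
  qed
  moreover have "?P * ?G \<in> carrier_mat (d 0) (d (Suc (Suc q)))" using IH(1) G by auto
  ultimately show ?case by (subst (1 2) mat_chain_prod_Suc) auto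
qed

text \<open>Every row of the matrix on the left is the vector of column sums, whatever
  \<open>m\<close> is, and the power \<open>- 1 / 2\<close> cancels the square root in these
  sums.\<close>

lemma linf_op_norm_ones_chain:
  assumes F: "\<And>r. r \<le> q \<Longrightarrow> F (Suc r) \<in> carrier_mat (d r) (d (Suc r))"
    and d: "\<And>r. r \<le> Suc q \<Longrightarrow> d r > 0" and "m > 0"
  shows "inverse (real (d (Suc q))) * (\<Prod>r<Suc q. real (d r)) powr (- 1 / 2) *
      linf_op_norm (ones_mat m (d 0) * mat_chain_prod F (Suc q)) =
    (\<Sum>j<d (Suc q). \<bar>\<Sum>i<d q. normalized_row d F q i * F (Suc q) $$ (i, j)\<bar>) / d (Suc q)"
proof -
  let ?P = "mat_chain_prod F (Suc q)" and ?c = "\<Prod>r<Suc q. real (d r)"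
  have P: "?P \<in> carrier_mat (d 0) (d (Suc q))"
    "\<And>j. j < d (Suc q) \<Longrightarrow> (\<Sum>i<d 0. ?P $$ (i, j)) =
      sqrt ?c * (\<Sum>i<d q. normalized_row d F q i * F (Suc q) $$ (i, j))"
    using column_sums_mat_chain_prod[of q F d] F d by auto
  have c: "?c > 0" using d by (intro prod_pos) auto
  have "linf_op_norm (ones_mat m (d 0) * ?P) = (\<Sum>j<d (Suc q). \<bar>\<Sum>i<d 0. ?P $$ (i, j)\<bar>)"
  proof (rule linf_op_norm_equal_rows)
    show "ones_mat m (d 0) * ?P \<in> carrier_mat m (d (Suc q))"
      using P(1) by (auto simp: ones_mat_def)
    show "(ones_mat m (d 0) * ?P) $$ (i, j) = (\<Sum>i<d 0. ?P $$ (i, j))" if "i < m" "j < d (Suc q)" for i j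
      using that P(1) by (auto simp: ones_mat_def scalar_prod_def lessThan_atLeast0)
  qed (use d \<open>m > 0\<close> in auto)
  also have "\<dots> = sqrt ?c * (\<Sum>j<d (Suc q). \<bar>\<Sum>i<d q. normalized_row d F q i * F (Suc q) $$ (i, j)\<bar>)"
    unfolding sum_distrib_left[of "sqrt ?c"] using c
    by (intro sum.cong) (simp_all add: P(2) abs_mult del: prod.lessThan_Suc)
  finally have norm: "linf_op_norm (ones_mat m (d 0) * ?P) =
    sqrt ?c * (\<Sum>j<d (Suc q). \<bar>\<Sum>i<d q. normalized_row d F q i * F (Suc q) $$ (i, j)\<bar>)" .
  have "x powr (- 1 / 2) * sqrt x = 1" if "x > 0" for x :: real
    using that by (simp add: powr_half_sqrt[symmetric] powr_add[symmetric])
  from this[OF c] have "?c powr (- 1 / 2) * sqrt ?c = 1" .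
  thus ?thesis unfolding norm by (simp add: field_simps del: prod.lessThan_Suc)
qed

text \<open>As \<open>2 * \<alpha>\<close> exceeds 2, the square is dominated by
  \<open>1 + \<bar>x\<bar> powr (2 * \<alpha>)\<close>; with mean 0, the variance is the second
  moment.\<close>

lemma standardized_lawI:
  assumes "\<alpha> > 1" "real_distribution \<mu>" "integrable \<mu> (\<lambda>x. \<bar>x\<bar> powr (2 * \<alpha>))"
    "prob_space.expectation \<mu> (\<lambda>x. x) = 0" "prob_space.variance \<mu> (\<lambda>x. x) = 1"
  shows "standardized_law \<mu>"
proof -
  interpret real_distribution \<mu> by fact
  have "x\<^sup>2 \<le> 1 + \<bar>x\<bar> powr (2 * \<alpha>)" for x :: real
  proof (cases "\<bar>x\<bar> \<le> 1")
    case True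
    hence "x\<^sup>2 \<le> 1" by (simp add: abs_square_le_1)
    thus ?thesis by (smt (verit) powr_ge_zero)
  next
    case False
    hence "\<bar>x\<bar> powr 2 \<le> \<bar>x\<bar> powr (2 * \<alpha>)" using assms(1) by (intro powr_mono) auto
    moreover have "\<bar>x\<bar> powr 2 = x\<^sup>2" using False by (subst powr_numeral) auto
    ultimately show ?thesis by simp
  qed
  hence bound: "AE x in \<mu>. norm (x\<^sup>2) \<le> norm (1 + \<bar>x\<bar> powr (2 * \<alpha>))"
    by (intro AE_I2) simp
  have "integrable \<mu> (\<lambda>x. 1 + \<bar>x\<bar> powr (2 * \<alpha>))" using assms(3) by simp
  hence "integrable \<mu> (\<lambda>x. x\<^sup>2)"
    by (rule Bochner_Integration.integrable_bound[OF _ _ bound]) simp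
  thus ?thesis using assms(2,4,5) by (simp add: standardized_law_def standardized_law_axioms_def)
qed

theorem theorem1p6:
  fixes \<alpha> :: real and p m :: nat
    and \<mu> :: "nat \<Rightarrow> real measure"
    and M :: "nat list \<Rightarrow> 'w measure"
    and A :: "nat list \<Rightarrow> nat \<Rightarrow> 'w \<Rightarrow> real mat"
  assumes "\<alpha> > 1" and "p \<ge> 1" and "m \<ge> 1"
    and law: "\<And>q. q \<in> {1..p} \<Longrightarrow> real_distribution (\<mu> q)"
    and moment: "\<And>q. q \<in> {1..p} \<Longrightarrow> integrable (\<mu> q) (\<lambda>x. \<bar>x\<bar> powr (2 * \<alpha>))"
    and centered: "\<And>q. q \<in> {1..p} \<Longrightarrow> prob_space.expectation (\<mu> q) (\<lambda>x. x) = 0"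
    and unit_variance: "\<And>q. q \<in> {1..p} \<Longrightarrow> prob_space.variance (\<mu> q) (\<lambda>x. x) = 1"
    and prob: "\<And>ns. length ns = p + 1 \<Longrightarrow> (\<forall>q\<le>p. ns ! q \<ge> 1) \<Longrightarrow> prob_space (M ns)"
    and indep: "\<And>ns. length ns = p + 1 \<Longrightarrow> (\<forall>q\<le>p. ns ! q \<ge> 1) \<Longrightarrow>
      prob_space.indep_vars (M ns) (\<lambda>q. borel_mat (ns ! (q - 1)) (ns ! q)) (A ns) {1..p}"
    and iid: "\<And>ns q. length ns = p + 1 \<Longrightarrow> (\<forall>q\<le>p. ns ! q \<ge> 1) \<Longrightarrow> q \<in> {1..p} \<Longrightarrow>
      iid_entries (M ns) (A ns q) (ns ! (q - 1)) (ns ! q) (\<mu> q)"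
  shows "tendsto_in_prob_comparable p M
    (\<lambda>ns \<omega>. inverse (real (ns ! p)) * (\<Prod>q<p. real (ns ! q)) powr (- 1 / 2) *
       linf_op_norm (ones_mat m (ns ! 0) * mat_chain_prod (\<lambda>q. A ns q \<omega>) p))
    (\<lambda>_. sqrt (2 / pi))"
  unfolding tendsto_in_prob_comparable_def
proof (intro allI impI)
  fix C \<epsilon> \<delta> :: real assume "\<epsilon> > 0" "\<delta> > 0"
  obtain k where p: "p = Suc k" using \<open>p \<ge> 1\<close> by (cases p) auto
  have std: "standardized_law (\<mu> q)" if "q \<in> {1..Suc k}" for q
    using that assms(1) law moment centered unit_variance unfolding p by (intro standardized_lawI)
  \<comment> \<open>One parameter serves both as deviation and as probability in
    \<open>abs_mean_last_factor\<close>.\<close>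
  define \<eta> where "\<eta> = min \<epsilon> \<delta>"
  have "\<eta> > 0" "\<eta> \<le> \<epsilon>" "\<eta> \<le> \<delta>" using \<open>\<epsilon> > 0\<close> \<open>\<delta> > 0\<close> unfolding \<eta>_def by auto
  from abs_mean_last_factor[OF std \<open>\<eta> > 0\<close>] obtain N where
    N: "\<forall>(M :: 'w measure) d A. iid_matrix_chain M d (Suc k) A \<mu> \<longrightarrow> (\<forall>r\<le>Suc k. N \<le> d r) \<longrightarrow>
      measure M {\<omega> \<in> space M.
        \<bar>(\<Sum>j<d (Suc k). \<bar>\<Sum>i<d k. normalized_row d (\<lambda>r. A r \<omega>) k i * A (Suc k) \<omega> $$ (i, j)\<bar>) / d (Suc k)
          - sqrt (2 / pi)\<bar> \<ge> \<eta>} \<le> \<eta>"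
    by (rule exE)
  show "\<exists>N. \<forall>ns. length ns = p + 1 \<longrightarrow>
      (\<forall>q\<le>p. \<forall>q'\<le>p. N \<le> ns ! q \<and> real (ns ! q) \<le> C * real (ns ! q')) \<longrightarrow>
      measure (M ns) {\<omega> \<in> space (M ns). \<epsilon> \<le> \<bar>inverse (real (ns ! p)) *
        (\<Prod>q<p. real (ns ! q)) powr (- 1 / 2) *
        linf_op_norm (ones_mat m (ns ! 0) * mat_chain_prod (\<lambda>q. A ns q \<omega>) p) - sqrt (2 / pi)\<bar>} \<le> \<delta>"
  \<comment> \<open>The maximum with 1 makes all dimensions positive, as the hypotheses on
    \<open>M\<close> and \<open>A\<close> and the normalization require.\<close>
  proof (intro exI[of _ "max N 1"] allI impI)
    fix ns :: "nat list"
    assume len: "length ns = p + 1"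
      and "\<forall>q\<le>p. \<forall>q'\<le>p. max N 1 \<le> ns ! q \<and> real (ns ! q) \<le> C * real (ns ! q')"
    hence ge: "\<forall>q\<le>p. N \<le> ns ! q" and pos: "\<forall>q\<le>p. 1 \<le> ns ! q" by auto
    define d where "d = (\<lambda>r. ns ! r)"
    interpret prob_space "M ns" using prob len pos .
    interpret iid_matrix_chain "M ns" d "Suc k" "A ns" \<mu>
      by unfold_locales (use indep[OF len pos] iid[OF len pos] in \<open>simp_all add: d_def p\<close>)
    let ?w = "\<lambda>\<omega> j. \<Sum>i<d k. row k \<omega> i * A ns (Suc k) \<omega> $$ (i, j)"
    \<comment> \<open>Stated only on the sample space, since the factors are known to have the right
      dimensions only there.\<close>
    have U: "inverse (real (ns ! p)) * (\<Prod>q<p. real (ns ! q)) powr (- 1 / 2) *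
        linf_op_norm (ones_mat m (ns ! 0) * mat_chain_prod (\<lambda>q. A ns q \<omega>) p) =
        (\<Sum>j<d (Suc k). \<bar>?w \<omega> j\<bar>) / d (Suc k)" if "\<omega> \<in> space (M ns)" for \<omega>
      using linf_op_norm_ones_chain[of k "\<lambda>q. A ns q \<omega>" d m] carrier_Suc[OF _ that] pos \<open>m \<ge> 1\<close>
      unfolding p d_def by (simp add: Suc_le_eq less_Suc_eq_le)
    have meas: "(\<lambda>\<omega>. (\<Sum>j<d (Suc k). \<bar>?w \<omega> j\<bar>) / d (Suc k)) \<in> borel_measurable (M ns)"
      by (intro borel_measurable_divide borel_measurable_sum borel_measurable_abs borel_measurable_times
          borel_measurable_const row_measurable entry_measurable) auto
    have "prob {\<omega> \<in> space (M ns). \<epsilon> \<le> \<bar>inverse (real (ns ! p)) *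
        (\<Prod>q<p. real (ns ! q)) powr (- 1 / 2) *
        linf_op_norm (ones_mat m (ns ! 0) * mat_chain_prod (\<lambda>q. A ns q \<omega>) p) - sqrt (2 / pi)\<bar>} \<le>
      prob {\<omega> \<in> space (M ns). \<bar>(\<Sum>j<d (Suc k). \<bar>?w \<omega> j\<bar>) / d (Suc k) - sqrt (2 / pi)\<bar> \<ge> \<eta>}"
    \<comment> \<open>Measurability is checked for the larger event, written with the explicit
      sum.\<close>
    proof (rule finite_measure_mono)
      show "{\<omega> \<in> space (M ns). \<bar>(\<Sum>j<d (Suc k). \<bar>?w \<omega> j\<bar>) / d (Suc k) - sqrt (2 / pi)\<bar> \<ge> \<eta>} \<in> events"
        using meas by measurable
    qed (use U \<open>\<eta> \<le> \<epsilon>\<close> in auto)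
    also have "\<dots> \<le> \<eta>"
      using N[rule_format, OF iid_matrix_chain_axioms] ge by (simp add: d_def p)
    finally show "prob {\<omega> \<in> space (M ns). \<epsilon> \<le> \<bar>inverse (real (ns ! p)) *
        (\<Prod>q<p. real (ns ! q)) powr (- 1 / 2) *
        linf_op_norm (ones_mat m (ns ! 0) * mat_chain_prod (\<lambda>q. A ns q \<omega>) p) - sqrt (2 / pi)\<bar>} \<le> \<delta>"
      using \<open>\<eta> \<le> \<delta>\<close> by linarith
  qed
qed

end
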